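(* Let $c>1$ and $p,q,r\ge0$ with $p+q+r=1$ be fixed such that $p,r>0$ and $p\ne r$. Then there is $k_0\in\mathbb{Z}$ such that $\mu^{(k)}\in ID^0$ for all $k\in\mathbb{Z}$ with $k<k_0$.
   Context: For $k\in\mathbb{Z}$ let $\{(N_t^{(k)},L_t^{(k)}),t\ge0\}$ be the bivariate compound Poisson process (pure jump, no drift) with $E[e^{i(z_1N_t^{(k)}+z_2L_t^{(k)})}]=\exp[t\int_{\mathbb{R}^2}(e^{i(z_1x_1+z_2x_2)}-1)\nu^{(k)}(dx)]$, where $\nu^{(k)}$ is concentrated on the points $(1,0)$, $(0,1)$, $(1,c^{-k})$ with masses $u,v,w\ge0$ respectively, and $p=u/(u+v+w)$, $q=v/(u+v+w)$, $r=w/(u+v+w)$. Define $\mu^{(k)}$ as the distribution of $\int_0^{\infty-}c^{-N^{(k)}_{s-}}\,dL_s^{(k)}$ (the almost sure limit of $\int_0^t$ as $t\to\infty$, which exists). It depends on $u,v,w$ only through $p,q,r$. A distribution $\sigma$ on $\mathbb{R}$ is quasi-infinitely divisible if its characteristic function is $\widehat\sigma(z)=\exp[i\gamma z-az^2+\int_{\mathbb{R}}(e^{izx}-1-izx1_{[-1,1]}(x))\,\nu_\sigma(dx)]$, where $\gamma,a\in\mathbb{R}$ and $\nu_\sigma$ is a signed measure (a difference $\nu_\sigma^+-\nu_\sigma^-$ of mutually singular measures, possibly both of infinite mass near $0$) with total variation measure $|\nu_\sigma|$ satisfying $\nu_\sigma(\{0\})=0$ and $\int(x^2\wedge1)\,|\nu_\sigma|(dx)<\infty$.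 $ID^0$ is the class of quasi-infinitely divisible distributions on $\mathbb{R}$ that are not infinitely divisible. *)

theory Defs
  imports "HOL-Probability.Probability"
begin

subsection \<open>Infinitely divisible and quasi-infinitely divisible distributions\<close>

definition convolution_power :: "real measure \<Rightarrow> nat \<Rightarrow> real measure" where
  "convolution_power \<rho> n = ((\<lambda>\<tau>. convolution \<rho> \<tau>) ^^ n) (return borel 0)"

definition infinitely_divisible :: "real measure \<Rightarrow> bool" where
  "infinitely_divisible \<sigma> \<longleftrightarrow>
     real_distribution \<sigma> \<and>
     (\<forall>n\<ge>1. \<exists>\<rho>. real_distribution \<rho> \<and> \<sigma> = convolution_power \<rho> n)"

text \<open>
  A signed L\'evy measure may have infinite positive and infinite negative part near the origin,
  so it is represented by the pair of its mutually singular positive and negative parts; the total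
  variation measure is their sum.
\<close>

definition mutually_singular :: "real measure \<Rightarrow> real measure \<Rightarrow> bool" where
  "mutually_singular \<nu>1 \<nu>2 \<longleftrightarrow>
     (\<exists>A\<in>sets borel. emeasure \<nu>1 A = 0 \<and> emeasure \<nu>2 (- A) = 0)"

definition quasi_levy_measure :: "real measure \<Rightarrow> real measure \<Rightarrow> bool" where
  "quasi_levy_measure \<nu>p \<nu>m \<longleftrightarrow>
     sets \<nu>p = sets borel \<and> sets \<nu>m = sets borel \<and> mutually_singular \<nu>p \<nu>m \<and>
     emeasure \<nu>p {0} = 0 \<and> emeasure \<nu>m {0} = 0 \<and>
     (\<integral>\<^sup>+ x. ennreal (min (x\<^sup>2) 1) \<partial>\<nu>p) + (\<integral>\<^sup>+ x. ennreal (min (x\<^sup>2) 1) \<partial>\<nu>m) < \<infinity>"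

definition levy_khintchine_integrand :: "real \<Rightarrow> real \<Rightarrow> complex" where
  "levy_khintchine_integrand z x =
     iexp (z * x) - 1 - \<i> * of_real (z * x * indicator {-1..1} x)"

definition quasi_infinitely_divisible :: "real measure \<Rightarrow> bool" where
  "quasi_infinitely_divisible \<sigma> \<longleftrightarrow>
     real_distribution \<sigma> \<and>
     (\<exists>(\<gamma>::real) (a::real) \<nu>p \<nu>m. quasi_levy_measure \<nu>p \<nu>m \<and>
        (\<forall>z. char \<sigma> z =
           exp (\<i> * of_real (\<gamma> * z) - of_real (a * z\<^sup>2)
                + ((CLINT x|\<nu>p. levy_khintchine_integrand z x)
                   - (CLINT x|\<nu>m. levy_khintchine_integrand z x)))))"

definition ID0 :: "real measure set" where
  "ID0 = {\<sigma>. quasi_infinitely_divisible \<sigma> \<and> \<not> infinitely_divisible \<sigma>}"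


subsection \<open>Compound Poisson processes\<close>

definition cadlag :: "(real \<Rightarrow> 'b::topological_space) \<Rightarrow> bool" where
  "cadlag f \<longleftrightarrow>
     (\<forall>t\<ge>0. continuous (at_right t) f) \<and> (\<forall>t>0. \<exists>l. (f \<longlongrightarrow> l) (at_left t))"

text \<open>
  Processes are indexed by all reals but only their values at times \<open>t \<ge> 0\<close> are constrained.
  Stochastic continuity is not listed, since it follows from stationarity of the increments and
  right-continuity of the paths at time 0.
\<close>

definition levy_process :: "'a measure \<Rightarrow> (real \<Rightarrow> 'a \<Rightarrow> 'b::euclidean_space) \<Rightarrow> bool" where
  "levy_process M Z \<longleftrightarrow>
     prob_space M \<and>
     (\<forall>t\<ge>0. Z t \<in> borel_measurable M) \<and>
     (AE \<omega> in M. Z 0 \<omega> = 0) \<and>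
     (\<forall>(t::nat \<Rightarrow> real) n. 0 \<le> t 0 \<and> mono t \<longrightarrow>
        prob_space.indep_vars M (\<lambda>_. borel) (\<lambda>i \<omega>. Z (t (Suc i)) \<omega> - Z (t i) \<omega>) {..<n}) \<and>
     (\<forall>s\<ge>0. \<forall>h\<ge>0. distr M borel (\<lambda>\<omega>. Z (s + h) \<omega> - Z s \<omega>) = distr M borel (Z h)) \<and>
     (AE \<omega> in M. cadlag (\<lambda>t. Z t \<omega>))"

definition compound_poisson_process ::
    "'a measure \<Rightarrow> (real \<Rightarrow> 'a \<Rightarrow> 'b::euclidean_space) \<Rightarrow> 'b measure \<Rightarrow> bool" where
  "compound_poisson_process M Z \<nu> \<longleftrightarrow>
     levy_process M Z \<and>
     (\<forall>t\<ge>0. \<forall>z. (CLINT \<omega>|M. iexp (z \<bullet> Z t \<omega>)) =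
        exp (of_real t * (CLINT x|\<nu>. iexp (z \<bullet> x) - 1)))"


subsection \<open>The distributions under consideration\<close>

definition jump_measure :: "real \<Rightarrow> int \<Rightarrow> real \<Rightarrow> real \<Rightarrow> real \<Rightarrow> (real \<times> real) measure" where
  "jump_measure c k u v w =
     measure_of UNIV (sets borel)
       (\<lambda>B. ennreal (u * indicator B (1, 0) + v * indicator B (0, 1)
                     + w * indicator B (1, c powi (- k))))"

lemma sets_jump_measure [simp, measurable_cong]: "sets (jump_measure c k u v w) = sets borel"
  unfolding jump_measure_def using sets.sigma_sets_eq[of "borel :: (real \<times> real) measure"] by simp

lemma space_jump_measure [simp]: "space (jump_measure c k u v w) = UNIV"
  unfolding jump_measure_def by (rule space_measure_of) simp

lemma emeasure_jump_measure:
  assumes "u \<ge> 0" "v \<ge> 0" "w \<ge> 0" "B \<in> sets borel"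
  shows "emeasure (jump_measure c k u v w) B =
    ennreal (u * indicator B (1, 0) + v * indicator B (0, 1) + w * indicator B (1, c powi (- k)))"
proof (rule emeasure_measure_of[OF jump_measure_def])
  let ?\<mu> = "\<lambda>B. ennreal (u * indicator B (1, 0) + v * indicator B (0, 1)
                     + w * indicator B (1::real, c powi (- k)))"
  have sets_eq: "sets (jump_measure c k u v w) = sets borel" by simp
  show "countably_additive (sets (jump_measure c k u v w)) ?\<mu>"
  proof (rule countably_additiveI)
    fix A :: "nat \<Rightarrow> (real \<times> real) set"
    assume "range A \<subseteq> sets (jump_measure c k u v w)" and disj: "disjoint_family A"
    have s: "(\<lambda>i. indicator (A i) x :: real) sums indicator (\<Union>i. A i) x" for x
    proof (cases "x \<in> (\<Union>i. A i)")
      case True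
      then obtain j where j: "x \<in> A j" by auto
      have "indicator (A i) x = (if i = j then 1 else 0 :: real)" for i
        using disj j by (auto simp: disjoint_family_on_def indicator_def)
      then show ?thesis using True sums_single[of j "\<lambda>_. 1::real"] by simp
    next
      case False
      then show ?thesis by simp
    qed
    have "(\<lambda>i. u * indicator (A i) (1, 0) + v * indicator (A i) (0, 1)
            + w * indicator (A i) (1, c powi (- k))) sums
          (u * indicator (\<Union>i. A i) (1, 0) + v * indicator (\<Union>i. A i) (0, 1)
            + w * indicator (\<Union>i. A i) (1, c powi (- k)))"
      by (intro sums_add sums_mult s)
    then show "(\<Sum>i. ?\<mu> (A i)) = ?\<mu> (\<Union>i. A i)"
      using assms by (intro suminf_ennreal_eq) (auto simp: indicator_def)
  qed
  show "positive (sets (jump_measure c k u v w)) ?\<mu>" by (simp add: positive_def)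
qed (use assms in auto)

text \<open>
  The pathwise integral of \<open>c\<close> to the power \<open>- N\<^sub>s\<^sub>-\<close> against \<open>dL\<^sub>s\<close> over \<open>(0,t]\<close>, where
  \<open>Z = (N, L)\<close>.  All jumps of \<open>L\<close> are positive, so almost all of its paths are nondecreasing and
  the integral is a Lebesgue-Stieltjes integral; the paths of \<open>L\<close> are extended to negative times
  by their value at 0.
\<close>

definition exp_integral ::
    "real \<Rightarrow> (real \<Rightarrow> 'a \<Rightarrow> real \<times> real) \<Rightarrow> real \<Rightarrow> 'a \<Rightarrow> real" where
  "exp_integral c Z t \<omega> =
     (LINT s:{0<..t}|interval_measure (\<lambda>s. snd (Z (max 0 s) \<omega>)).
        c powr (- Lim (at_left s) (\<lambda>r. fst (Z r \<omega>))))"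

text \<open>
  \<open>\<mu>\<close> is the distribution of the almost sure limit of the integrals over \<open>(0,t]\<close> as \<open>t\<close> tends to
  infinity.  The limit is unique up to null sets, hence there is at most one such \<open>\<mu>\<close>.
\<close>

definition is_exp_integral_law ::
    "real \<Rightarrow> 'a measure \<Rightarrow> (real \<Rightarrow> 'a \<Rightarrow> real \<times> real) \<Rightarrow> real measure \<Rightarrow> bool" where
  "is_exp_integral_law c M Z \<mu> \<longleftrightarrow>
     (\<exists>X\<in>borel_measurable M.
        (AE \<omega> in M. ((\<lambda>t. exp_integral c Z t \<omega>) \<longlongrightarrow> X \<omega>) at_top) \<and> \<mu> = distr M borel X)"

end

theory Submission
  imports Defs
begin

text \<open>
  Put \<open>\<kappa> = c\<^bsup>-k\<^esup>\<close>.  The functional equation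
  \<open>(1 - q e\<^bsup>iz\<^esup>) g(z) = (p + r e\<^bsup>i\<kappa>z\<^esup>) g(z / c)\<close> has a solution \<open>g = exp \<psi>\<close>, where \<open>\<psi>\<close> is obtained by
  summing the logarithmic series of \<open>(p + r e\<^bsup>i\<kappa>z\<^esup>) / (1 - q e\<^bsup>iz\<^esup>)\<close> over the scaled arguments
  \<open>c\<^bsup>-n\<^esup> z\<close>.  Hence \<open>\<psi>\<close> is a L\'evy-Khintchine exponent with a discrete signed measure that has a
  finite first absolute moment.

  The functional equation says that \<open>exp (i z I\<^sub>t) g(c\<^bsup>-N(t)\<^esup> z)\<close> is a martingale, where \<open>I\<^sub>t\<close> is
  the integral over \<open>(0,t]\<close>; since \<open>N(t)\<close> tends to infinity, \<open>g\<close> is the characteristic function of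
  \<open>\<mu>\<^bsup>(k)\<^esup>\<close>.  The martingale property is obtained in the limit of Riemann sums with mesh \<open>h\<close>, with an
  error \<open>O(h\<^sup>2)\<close> per step.

  If \<open>exp \<psi>\<close> is infinitely divisible, then \<open>\<psi>\<close> is conditionally positive definite, and testing this
  with Fejer-type trigonometric polynomials shows that all atoms of the signed measure are
  nonnegative.  But the even terms of the logarithmic series of \<open>p + r e\<^bsup>i\<kappa>z\<^esup>\<close> have negative
  weights, and one of them is not compensated by other terms if \<open>\<kappa>\<close> is large.
\<close>

subsection \<open>Discrete signed L\'evy measures\<close>

text \<open>Every scaling by a power of c repeats the whole logarithmic series, so the weights of
  the signed measure are not summable. Only the shrinking jump sizes give convergence, so the first
  absolute moment is the quantity carried through all estimates.

  Different indices may produce the same jump, so a negative term of the series proves nothing until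
  all terms at its point are collected. Terms of the series of \<open>1 - q e^(iz)\<close> become
  negligible for large \<kappa>; positive terms from scaled copies of the same series are limited by
  an arithmetic argument on powers of c.

  The condition \<open>p \<noteq> r\<close> makes the ratio in the logarithmic series smaller than
  1. For \<open>p = r\<close> the function \<open>p + r e^(i\<kappa>z)\<close> has real zeros, which
  no exponential has.

  The natural derivation of the functional equation conditions on the first jump. Here the process
  is given only by its joint characteristic function, independent stationary increments and path
  regularity, and jump times are never constructed. This is why the argument passes through small
  time steps.\<close>

lemma norm_iexp_minus_one: "norm (iexp a - 1) \<le> \<bar>a\<bar>"
  using iexp_approx1[of a 0] by simp

text \<open>Atoms are listed with repetition: index i puts weight \<open>w i\<close> at the point
  \<open>x i\<close>, and several indices may share a point. Integrability over the counting measure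
  is absolute convergence of the first moment.\<close>

locale jump_sequence =
  fixes w x :: "'i::countable \<Rightarrow> real"
  assumes integrable_jumps: "integrable (count_space UNIV) (\<lambda>i. w i * x i)"
begin

text \<open>The net atom after cancellation among indices with the same jump. The fiber over 0 may
  fail to be summable, so the point 0 is excluded from all sums over jump values.\<close>

definition mass :: "real \<Rightarrow> real" where
  "mass y = (\<integral>i. w i * indicator {i. x i = y} i \<partial>count_space UNIV)"

lemma integrable_linear_bound:
  fixes g :: "real \<Rightarrow> 'b::{banach, second_countable_topology}"
  assumes "\<And>y. norm (g y) \<le> C * \<bar>y\<bar>"
  shows "integrable (count_space UNIV) (\<lambda>i. w i *\<^sub>R g (x i))"
proof (rule Bochner_Integration.integrable_bound)
  show "integrable (count_space UNIV) (\<lambda>i. C * (w i * x i))"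
    using integrable_jumps by simp
  show "AE i in count_space UNIV. norm (w i *\<^sub>R g (x i)) \<le> norm (C * (w i * x i))"
  proof (rule AE_I2)
    fix i
    have "norm (w i *\<^sub>R g (x i)) \<le> \<bar>w i\<bar> * (C * \<bar>x i\<bar>)"
      by (simp add: assms mult_left_mono)
    also have "\<dots> \<le> norm (C * (w i * x i))"
      by (simp add: abs_mult mult.left_commute mult_right_mono)
    finally show "norm (w i *\<^sub>R g (x i)) \<le> norm (C * (w i * x i))" .
  qed
qed auto

text \<open>Markov's inequality: the indicator of \<open>{y}\<close> is at most
  \<open>1 / \<bar>y\<bar>\<close> times the absolute value, so the first moment controls every
  fiber away from 0.\<close>

lemma integrable_fiber:
  assumes "y \<noteq> 0"
  shows "integrable (count_space UNIV) (\<lambda>i. w i * indicator {i. x i = y} i)"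
proof -
  have "integrable (count_space UNIV) (\<lambda>i. w i *\<^sub>R (indicator {y} (x i) :: real))"
    by (rule integrable_linear_bound[where C = "1 / \<bar>y\<bar>"])
       (use assms in \<open>auto simp: indicator_def\<close>)
  moreover have "(indicator {y} (x i) :: real) = indicator {i. x i = y} i" for i
    by (auto simp: indicator_def)
  ultimately show ?thesis by simp
qed

text \<open>Regrouping by the value of the jump is Fubini for a kernel supported on the graph
  \<open>x i = y\<close>. The linear bound forces \<open>g 0 = 0\<close>, so leaving out the value 0
  loses nothing.\<close>

lemma
  fixes g :: "real \<Rightarrow> 'b::{banach, second_countable_topology}"
  assumes g: "\<And>y. norm (g y) \<le> C * \<bar>y\<bar>"
  shows integrable_mass: "integrable (count_space (range x - {0})) (\<lambda>y. mass y *\<^sub>R g y)"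
    and integral_mass: "(\<integral>y. mass y *\<^sub>R g y \<partial>count_space (range x - {0})) =
           (\<integral>i. w i *\<^sub>R g (x i) \<partial>count_space UNIV)"
proof -
  define D where "D = range x - {0}"
  have cD: "countable D" by (simp add: D_def)
  have g0: "g 0 = 0" using g[of 0] by simp
  interpret pair_sigma_finite "count_space (UNIV :: 'i set)" "count_space D"
    using cD by (simp add: pair_sigma_finite_def sigma_finite_measure_count_space_countable)
  have prod: "count_space (UNIV :: 'i set) \<Otimes>\<^sub>M count_space D = count_space (UNIV \<times> D)"
    using cD by (simp add: pair_measure_countable)
  define f where "f = (\<lambda>i y. (w i * indicator {i. x i = y} i) *\<^sub>R g y)"
  have f_eq: "f i y = indicator {x i} y *\<^sub>R (w i *\<^sub>R g (x i))" for i y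
    by (auto simp: f_def indicator_def)
  have single: "has_bochner_integral (count_space D) (\<lambda>y. indicator {x i} y *\<^sub>R h)
      (if x i \<in> D then h else 0)" for i and h :: "'c::{banach, second_countable_topology}"
  proof (cases "x i \<in> D")
    case True
    then have "emeasure (count_space D) {x i} = 1" by simp
    then have "has_bochner_integral (count_space D) (\<lambda>y. indicator {x i} y *\<^sub>R h)
        (measure (count_space D) {x i} *\<^sub>R h)"
      using True by (intro has_bochner_integral_indicator) auto
    then show ?thesis using True by (simp add: measure_def)
  next
    case False
    have "has_bochner_integral (count_space D) (\<lambda>y. 0 :: 'c) 0"
      by (rule has_bochner_integral_zero)
    moreover have "indicator {x i} y *\<^sub>R h = 0" if "y \<in> D" for y
      using that False by (auto simp: indicator_def)
    ultimately show ?thesis using False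
      by (subst has_bochner_integral_cong[OF refl, where g = "\<lambda>y. 0" and y = 0]) auto
  qed
  have notD: "g (x i) = 0" if "x i \<notin> D" for i
    using that g0 by (auto simp: D_def)
  have inner1: "(\<integral>y. f i y \<partial>count_space D) = w i *\<^sub>R g (x i)" for i
    using has_bochner_integral_integral_eq[OF single[of i "w i *\<^sub>R g (x i)"]] notD[of i]
    by (simp add: f_eq)
  have nf: "norm (f i y) = indicator {x i} y *\<^sub>R norm (w i *\<^sub>R g (x i))" for i y
    by (simp add: f_eq indicator_def)
  have innern: "(\<integral>y. norm (f i y) \<partial>count_space D) = norm (w i *\<^sub>R g (x i))" for i
    using has_bochner_integral_integral_eq[OF single[of i "norm (w i *\<^sub>R g (x i))"]] notD[of i]
    unfolding nf by auto
  have int_f: "integrable (count_space UNIV \<Otimes>\<^sub>M count_space D) (\<lambda>(i, y). f i y)"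
  proof (rule Fubini_integrable)
    show "(\<lambda>(i, y). f i y) \<in> borel_measurable (count_space UNIV \<Otimes>\<^sub>M count_space D)"
      by (simp add: prod)
    show "integrable (count_space UNIV) (\<lambda>i. \<integral>y. norm (case (i, y) of (i, y) \<Rightarrow> f i y) \<partial>count_space D)"
      using integrable_norm[OF integrable_linear_bound[OF g]] by (simp add: innern)
    show "AE i in count_space UNIV. integrable (count_space D) (\<lambda>y. case (i, y) of (i, y) \<Rightarrow> f i y)"
      unfolding f_eq prod.case by (rule AE_I2) (rule integrable.intros[OF single])
  qed
  have inner2: "(\<integral>i. f i y \<partial>count_space UNIV) = mass y *\<^sub>R g y" if "y \<in> D" for y
    unfolding f_def mass_def
    by (rule integral_scaleR_left) (use integrable_fiber that in \<open>auto simp: D_def\<close>)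
  have "integrable (count_space D) (\<lambda>y. \<integral>i. f i y \<partial>count_space UNIV)"
    using integrable_snd[OF int_f] .
  then show "integrable (count_space (range x - {0})) (\<lambda>y. mass y *\<^sub>R g y)"
    using inner2 unfolding D_def[symmetric]
    by (subst Bochner_Integration.integrable_cong[OF refl]) auto
  have "(\<integral>y. mass y *\<^sub>R g y \<partial>count_space D) = (\<integral>y. (\<integral>i. f i y \<partial>count_space UNIV) \<partial>count_space D)"
    by (rule Bochner_Integration.integral_cong) (auto simp: inner2)
  also have "\<dots> = (\<integral>i. (\<integral>y. f i y \<partial>count_space D) \<partial>count_space UNIV)"
    by (rule Fubini_integral[OF int_f])
  finally show "(\<integral>y. mass y *\<^sub>R g y \<partial>count_space (range x - {0})) =
           (\<integral>i. w i *\<^sub>R g (x i) \<partial>count_space UNIV)"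
    by (simp only: inner1 D_def[symmetric])
qed

text \<open>A density with respect to counting on the nonzero jump values, pushed forward to the
  Borel sets. Negative values of F are cut to 0 by \<open>ennreal\<close>.\<close>

definition atomic_measure :: "(real \<Rightarrow> real) \<Rightarrow> real measure" where
  "atomic_measure F =
     distr (density (count_space (range x - {0})) (\<lambda>y. ennreal (F y))) borel (\<lambda>y. y)"

lemma sets_atomic_measure [simp]: "sets (atomic_measure F) = sets borel"
  by (simp add: atomic_measure_def)

lemma nn_integral_atomic_measure:
  assumes "f \<in> borel_measurable borel"
  shows "(\<integral>\<^sup>+y. f y \<partial>atomic_measure F) = (\<integral>\<^sup>+y. ennreal (F y) * f y \<partial>count_space (range x - {0}))"
  unfolding atomic_measure_def using assms by (simp add: nn_integral_distr nn_integral_density)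

lemma emeasure_atomic_measure_eq_0:
  assumes "A \<in> sets borel" and "\<And>y. y \<in> A \<Longrightarrow> y \<in> range x \<Longrightarrow> y \<noteq> 0 \<Longrightarrow> F y \<le> 0"
  shows "emeasure (atomic_measure F) A = 0"
proof -
  have "emeasure (atomic_measure F) A = (\<integral>\<^sup>+y. indicator A y \<partial>atomic_measure F)"
    using assms(1) by simp
  also have "\<dots> = (\<integral>\<^sup>+y. ennreal (F y) * indicator A y \<partial>count_space (range x - {0}))"
    using assms(1) by (intro nn_integral_atomic_measure) simp
  also have "\<dots> = (\<integral>\<^sup>+y. 0 \<partial>count_space (range x - {0}))"
    by (rule nn_integral_cong) (use assms(2) in \<open>auto simp: indicator_def ennreal_neg\<close>)
  finally show ?thesis by simp
qed

lemma integral_atomic_measure: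
  fixes g :: "real \<Rightarrow> complex"
  assumes g: "\<And>y. norm (g y) \<le> C * \<bar>y\<bar>" and [measurable]: "g \<in> borel_measurable borel"
    and F: "\<And>y. 0 \<le> F y" "\<And>y. F y \<le> \<bar>mass y\<bar>"
  shows "integrable (count_space (range x - {0})) (\<lambda>y. F y *\<^sub>R g y)"
    and "(\<integral>y. g y \<partial>atomic_measure F) = (\<integral>y. F y *\<^sub>R g y \<partial>count_space (range x - {0}))"
proof -
  show "integrable (count_space (range x - {0})) (\<lambda>y. F y *\<^sub>R g y)"
    by (rule Bochner_Integration.integrable_bound[OF integrable_mass[OF g]])
       (use F in \<open>auto intro!: mult_right_mono\<close>)
  show "(\<integral>y. g y \<partial>atomic_measure F) = (\<integral>y. F y *\<^sub>R g y \<partial>count_space (range x - {0}))"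
    unfolding atomic_measure_def using F by (simp add: integral_distr integral_density)
qed

text \<open>The Jordan decomposition of the net masses: the countable set of jump values with
  negative mass separates the two parts, and \<open>min (y\<^sup>2) 1 \<le> \<bar>y\<bar>\<close>
  reduces the integrability condition to the first moment.\<close>

lemma quasi_levy_measure_mass:
  "quasi_levy_measure (atomic_measure (\<lambda>y. max 0 (mass y))) (atomic_measure (\<lambda>y. max 0 (- mass y)))"
proof -
  have fin: "(\<integral>\<^sup>+y. ennreal (min (y\<^sup>2) 1) \<partial>atomic_measure F) < \<infinity>"
    if F: "\<And>y. 0 \<le> F y" "\<And>y. F y \<le> \<bar>mass y\<bar>" for F
  proof -
    have "(\<integral>\<^sup>+y. ennreal (min (y\<^sup>2) 1) \<partial>atomic_measure F) =
        (\<integral>\<^sup>+y. ennreal (F y) * ennreal (min (y\<^sup>2) 1) \<partial>count_space (range x - {0}))"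
      by (rule nn_integral_atomic_measure) simp
    also have "\<dots> \<le> (\<integral>\<^sup>+y. ennreal (norm (mass y *\<^sub>R y)) \<partial>count_space (range x - {0}))"
    proof (rule nn_integral_mono)
      fix y :: real
      have "min (y\<^sup>2) 1 \<le> \<bar>y\<bar>"
      proof (cases "\<bar>y\<bar> \<le> 1")
        case True
        have "y\<^sup>2 = \<bar>y\<bar> * \<bar>y\<bar>" by (simp add: power2_eq_square)
        also have "\<dots> \<le> 1 * \<bar>y\<bar>" using True by (rule mult_right_mono) simp
        finally show ?thesis by simp
      qed simp
      then have "F y * min (y\<^sup>2) 1 \<le> \<bar>mass y\<bar> * \<bar>y\<bar>"
        using F[of y] by (intro mult_mono) auto
      then show "ennreal (F y) * ennreal (min (y\<^sup>2) 1) \<le> ennreal (norm (mass y *\<^sub>R y))"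
        using F[of y] by (simp add: ennreal_mult[symmetric] abs_mult ennreal_leI)
    qed
    also have "\<dots> < \<infinity>"
      using integrable_mass[of "\<lambda>y. y" 1] unfolding integrable_iff_bounded by simp
    finally show ?thesis .
  qed
  have "mutually_singular (atomic_measure (\<lambda>y. max 0 (mass y))) (atomic_measure (\<lambda>y. max 0 (- mass y)))"
    unfolding mutually_singular_def
  proof (intro bexI conjI)
    define A where "A = {y \<in> range x. mass y < 0}"
    have "countable A" by (auto simp: A_def)
    then show A: "A \<in> sets borel" by (rule sets.countable[rotated]) auto
    show "emeasure (atomic_measure (\<lambda>y. max 0 (mass y))) A = 0"
      using A by (rule emeasure_atomic_measure_eq_0) (auto simp: A_def)
    show "emeasure (atomic_measure (\<lambda>y. max 0 (- mass y))) (- A) = 0"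
      using A by (intro emeasure_atomic_measure_eq_0) (auto simp: A_def)
  qed
  moreover have "emeasure (atomic_measure F) {0} = 0" for F
    by (rule emeasure_atomic_measure_eq_0) auto
  moreover note fin[of "\<lambda>y. max 0 (mass y)"] fin[of "\<lambda>y. max 0 (- mass y)"]
  ultimately show ?thesis
    by (simp add: quasi_levy_measure_def)
qed

lemma integral_atomic_measure_diff:
  fixes g :: "real \<Rightarrow> complex"
  assumes g: "\<And>y. norm (g y) \<le> C * \<bar>y\<bar>" and m: "g \<in> borel_measurable borel"
  shows "(\<integral>y. g y \<partial>atomic_measure (\<lambda>y. max 0 (mass y))) - (\<integral>y. g y \<partial>atomic_measure (\<lambda>y. max 0 (- mass y)))
     = (\<integral>i. w i *\<^sub>R g (x i) \<partial>count_space UNIV)"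
proof -
  note i = integral_atomic_measure[OF g m]
  have "(\<integral>y. g y \<partial>atomic_measure (\<lambda>y. max 0 (mass y))) - (\<integral>y. g y \<partial>atomic_measure (\<lambda>y. max 0 (- mass y)))
     = (\<integral>y. max 0 (mass y) *\<^sub>R g y - max 0 (- mass y) *\<^sub>R g y \<partial>count_space (range x - {0}))"
    by (subst (1 2) i(2), auto) (subst Bochner_Integration.integral_diff, auto intro!: i(1))
  also have "\<dots> = (\<integral>y. mass y *\<^sub>R g y \<partial>count_space (range x - {0}))"
    by (rule Bochner_Integration.integral_cong) (auto simp: scaleR_left_diff_distrib[symmetric] max_def)
  also have "\<dots> = (\<integral>i. w i *\<^sub>R g (x i) \<partial>count_space UNIV)"
    by (rule integral_mass[OF g])
  finally show ?thesis .
qed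

definition exponent :: "real \<Rightarrow> complex" where
  "exponent z = (\<integral>i. w i *\<^sub>R (iexp (z * x i) - 1) \<partial>count_space UNIV)"

lemma integrable_exponent: "integrable (count_space UNIV) (\<lambda>i. w i *\<^sub>R (iexp (z * x i) - 1))"
  by (rule integrable_linear_bound[where g = "\<lambda>y. iexp (z * y) - 1" and C = "\<bar>z\<bar>"])
     (use norm_iexp_minus_one[of "z * _"] in \<open>simp add: abs_mult\<close>)

text \<open>With a finite first moment the compensator is summable by itself. It is moved into the
  drift, which changes \<gamma> to \<open>\<gamma>'\<close>; the Gaussian coefficient is 0.\<close>

lemma quasi_infinitely_divisibleI:
  assumes "real_distribution \<sigma>"
    and char: "\<And>z. char \<sigma> z = exp (\<i> * of_real (\<gamma> * z) + exponent z)"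
  shows "quasi_infinitely_divisible \<sigma>"
proof -
  define h where "h = (\<lambda>y::real. y * indicator {-1..1} y)"
  define \<gamma>' where "\<gamma>' = \<gamma> + (\<integral>i. w i * h (x i) \<partial>count_space UNIV)"
  have h: "norm (h y) \<le> 1 * \<bar>y\<bar>" for y by (auto simp: h_def indicator_def)
  have lk: "levy_khintchine_integrand z = (\<lambda>y. iexp (z * y) - 1 - \<i> * of_real (z * h y))" for z
    by (auto simp: levy_khintchine_integrand_def h_def fun_eq_iff)
  have bound: "norm (levy_khintchine_integrand z y) \<le> (2 * \<bar>z\<bar>) * \<bar>y\<bar>" for z y
  proof -
    have "norm (levy_khintchine_integrand z y) \<le> norm (iexp (z * y) - 1) + norm (\<i> * of_real (z * h y))"
      unfolding lk by (rule norm_triangle_ineq4)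
    also have "\<dots> \<le> \<bar>z * y\<bar> + \<bar>z * y\<bar>"
      by (rule add_mono[OF norm_iexp_minus_one])
         (use h[of y] in \<open>auto simp: norm_mult abs_mult intro!: mult_left_mono\<close>)
    finally show ?thesis by (simp add: abs_mult algebra_simps)
  qed
  have eq: "\<i> * of_real (\<gamma>' * z) - of_real (0 * z\<^sup>2)
      + ((\<integral>y. levy_khintchine_integrand z y \<partial>atomic_measure (\<lambda>y. max 0 (mass y)))
         - (\<integral>y. levy_khintchine_integrand z y \<partial>atomic_measure (\<lambda>y. max 0 (- mass y))))
      = \<i> * of_real (\<gamma> * z) + exponent z" for z
  proof -
    have [measurable]: "levy_khintchine_integrand z \<in> borel_measurable borel"
      unfolding lk h_def by measurable
    have "(\<integral>y. levy_khintchine_integrand z y \<partial>atomic_measure (\<lambda>y. max 0 (mass y)))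
         - (\<integral>y. levy_khintchine_integrand z y \<partial>atomic_measure (\<lambda>y. max 0 (- mass y)))
      = (\<integral>i. w i *\<^sub>R levy_khintchine_integrand z (x i) \<partial>count_space UNIV)"
      by (rule integral_atomic_measure_diff[OF bound]) measurable
    also have "\<dots> = (\<integral>i. w i *\<^sub>R (iexp (z * x i) - 1) - (\<i> * of_real z) * of_real (w i * h (x i)) \<partial>count_space UNIV)"
      by (rule Bochner_Integration.integral_cong) (auto simp: lk scaleR_conv_of_real algebra_simps)
    also have "\<dots> = exponent z - (\<i> * of_real z) * of_real (\<integral>i. w i * h (x i) \<partial>count_space UNIV)"
      unfolding exponent_def
      by (subst Bochner_Integration.integral_diff)
         (use integrable_exponent integrable_linear_bound[OF h] in \<open>auto simp del: of_real_mult\<close>)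
    finally show ?thesis by (simp add: \<gamma>'_def algebra_simps)
  qed
  show ?thesis
    unfolding quasi_infinitely_divisible_def
  proof (intro conjI exI allI)
    fix z
    show "char \<sigma> z = exp (\<i> * of_real (\<gamma>' * z) - of_real (0 * z\<^sup>2)
      + ((\<integral>y. levy_khintchine_integrand z y \<partial>atomic_measure (\<lambda>y. max 0 (mass y)))
         - (\<integral>y. levy_khintchine_integrand z y \<partial>atomic_measure (\<lambda>y. max 0 (- mass y)))))"
      by (simp only: eq char)
  qed (use assms quasi_levy_measure_mass in auto)
qed

end

subsection \<open>Exponents of infinitely divisible distributions\<close>

lemma char_convolution:
  assumes "real_distribution A" "real_distribution B"
  shows "real_distribution (convolution A B)"
    and "char (convolution A B) z = char A z * char B z"
proof -
  interpret A: real_distribution A by fact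
  interpret B: real_distribution B by fact
  interpret AB: pair_prob_space A B ..
  have conv: "convolution A B = distr (A \<Otimes>\<^sub>M B) borel (\<lambda>(a, b). a + b)"
    by (rule convolution_def)
  show "real_distribution (convolution A B)"
    unfolding conv by (rule AB.real_distribution_distr) simp
  have int: "integrable (A \<Otimes>\<^sub>M B) (\<lambda>(a, b). iexp (z * a) * iexp (z * b))"
    by (rule AB.integrable_const_bound[where B = 1]) (auto simp: norm_mult)
  have "char (convolution A B) z = (CLINT ab|A \<Otimes>\<^sub>M B. iexp (z * (fst ab + snd ab)))"
    unfolding char_def conv by (simp add: integral_distr split_beta)
  also have "\<dots> = (CLINT ab|A \<Otimes>\<^sub>M B. (case ab of (a, b) \<Rightarrow> iexp (z * a) * iexp (z * b)))"
    by (rule Bochner_Integration.integral_cong)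
       (auto simp: split_beta exp_add[symmetric] algebra_simps)
  also have "\<dots> = (CLINT a|A. CLINT b|B. iexp (z * a) * iexp (z * b))"
    using AB.integral_fst[OF int] by simp
  also have "\<dots> = char A z * char B z"
    by (simp add: char_def)
  finally show "char (convolution A B) z = char A z * char B z" .
qed

lemma char_convolution_power:
  assumes "real_distribution \<rho>"
  shows "real_distribution (convolution_power \<rho> n) \<and> char (convolution_power \<rho> n) z = char \<rho> z ^ n"
proof (induction n)
  case 0
  interpret r: prob_space "return borel (0::real)" by (rule prob_space_return) simp
  have "real_distribution (return borel (0::real))" by unfold_locales auto
  then show ?case
    by (simp add: convolution_power_def char_def integral_return)
next
  case (Suc n)
  have "convolution_power \<rho> (Suc n) = convolution \<rho> (convolution_power \<rho> n)"
    by (simp add: convolution_power_def)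
  then show ?case using Suc char_convolution[OF assms] by simp
qed

text \<open>The quotient is continuous on the connected line and takes values in the finite set of
  n-th roots of unity, hence is constant.\<close>

lemma continuous_root_unique:
  fixes f g :: "real \<Rightarrow> complex"
  assumes f: "continuous_on UNIV f" and g: "continuous_on UNIV g" and "n \<ge> 1"
    and eq: "\<And>z. f z ^ n = g z ^ n" and nz: "\<And>z. g z \<noteq> 0" and "f 0 = g 0"
  shows "f z = g z"
proof -
  have "(\<lambda>z. f z / g z) constant_on UNIV"
  proof (rule continuous_finite_range_constant)
    show "continuous_on UNIV (\<lambda>z. f z / g z)"
      using f g nz by (intro continuous_on_divide) auto
    have "range (\<lambda>z. f z / g z) \<subseteq> {\<zeta>. \<zeta> ^ n = 1}"
      using eq nz by (auto simp: power_divide)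
    moreover have "finite {\<zeta>::complex. \<zeta> ^ n = 1}"
      using \<open>n \<ge> 1\<close> by (intro finite_roots_unity)
    ultimately show "finite (range (\<lambda>z. f z / g z))" by (rule finite_subset)
  qed simp
  then obtain y where "\<And>z. f z / g z = y" by (auto simp: constant_on_def)
  then have "f z / g z = f 0 / g 0" by simp
  then show ?thesis using nz[of z] nz[of 0] \<open>f 0 = g 0\<close> by simp
qed

text \<open>
  The \<open>n\<close>-th root of \<open>\<sigma>\<close> has characteristic function \<open>exp (\<psi> / n)\<close>, and \<open>n (exp (\<psi> / n) - 1)\<close> tends
  to \<open>\<psi>\<close>; the subtracted constant does not contribute because the coefficients sum to 0.
\<close>

lemma infinitely_divisible_conditionally_positive:
  fixes a :: "'j \<Rightarrow> complex" and t :: "'j \<Rightarrow> real"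
  assumes id: "infinitely_divisible \<sigma>" and char: "\<And>z. char \<sigma> z = exp (\<psi> z)"
    and cont: "continuous_on UNIV \<psi>" and "\<psi> 0 = 0"
    and S: "finite S" and sum: "(\<Sum>j\<in>S. a j) = 0"
  shows "0 \<le> Re (\<Sum>j\<in>S. \<Sum>l\<in>S. a j * cnj (a l) * \<psi> (t j - t l))"
proof -
  define Q where "Q = (\<lambda>f :: real \<Rightarrow> complex. \<Sum>j\<in>S. \<Sum>l\<in>S. a j * cnj (a l) * f (t j - t l))"
  have nonneg: "0 \<le> Re (Q (\<lambda>z. of_nat n * (exp (\<psi> z / of_nat n) - 1)))" if n: "n \<ge> 1" for n
  proof -
    obtain \<rho> where \<rho>: "real_distribution \<rho>" "\<sigma> = convolution_power \<rho> n"
      using id n by (auto simp: infinitely_divisible_def)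
    interpret real_distribution \<rho> by fact
    have ch: "char \<rho> z = exp (\<psi> z / of_nat n)" for z
    proof (rule continuous_root_unique[where n = n])
      show "continuous_on UNIV (char \<rho>)"
        using isCont_char by (simp add: continuous_at_imp_continuous_on)
      show "continuous_on UNIV (\<lambda>z. exp (\<psi> z / of_nat n))"
        using cont n by (intro continuous_intros) auto
      show "char \<rho> z ^ n = exp (\<psi> z / of_nat n) ^ n" for z
        using char_convolution_power[OF \<rho>(1), of n z] \<rho>(2) char[of z] n
        by (simp add: exp_of_nat_mult[symmetric])
    qed (use n \<open>\<psi> 0 = 0\<close> char_zero in auto)
    have int: "integrable \<rho> (\<lambda>x. a j * cnj (a l) * iexp ((t j - t l) * x))" for j l
      by (intro integrable_mult_right integrable_iexp) auto
    have "Q (char \<rho>) = (CLINT x|\<rho>. (\<Sum>j\<in>S. \<Sum>l\<in>S. a j * cnj (a l) * iexp ((t j - t l) * x)))"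
      unfolding Q_def char_def using int by (simp add: integral_sum)
    also have "\<dots> = (CLINT x|\<rho>. of_real ((cmod (\<Sum>j\<in>S. a j * iexp (t j * x)))\<^sup>2))"
    proof (rule Bochner_Integration.integral_cong)
      fix x
      have "of_real ((cmod (\<Sum>j\<in>S. a j * iexp (t j * x)))\<^sup>2) =
          (\<Sum>j\<in>S. a j * iexp (t j * x)) * cnj (\<Sum>l\<in>S. a l * iexp (t l * x))"
        by (rule complex_norm_square)
      also have "\<dots> = (\<Sum>j\<in>S. \<Sum>l\<in>S. a j * cnj (a l) * iexp ((t j - t l) * x))"
        by (simp add: sum_product exp_cnj exp_diff exp_minus divide_inverse algebra_simps)
      finally show "(\<Sum>j\<in>S. \<Sum>l\<in>S. a j * cnj (a l) * iexp ((t j - t l) * x)) =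
          of_real ((cmod (\<Sum>j\<in>S. a j * iexp (t j * x)))\<^sup>2)" by simp
    qed simp
    finally have "Q (char \<rho>) = of_real (LINT x|\<rho>. (cmod (\<Sum>j\<in>S. a j * iexp (t j * x)))\<^sup>2)"
      by (simp only: integral_complex_of_real)
    then have "0 \<le> Re (Q (char \<rho>))" by simp
    moreover have "Q (\<lambda>z. of_nat n * (exp (\<psi> z / of_nat n) - 1)) = of_nat n * (Q (char \<rho>) - Q (\<lambda>_. 1))"
      unfolding Q_def ch by (simp add: sum_distrib_left sum_subtractf[symmetric] algebra_simps)
    moreover have "Q (\<lambda>_. 1) = (\<Sum>j\<in>S. a j) * (\<Sum>l\<in>S. cnj (a l))"
      unfolding Q_def by (simp add: sum_product)
    ultimately show ?thesis using sum by simp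
  qed
  \<comment> \<open>This is the derivative of \<open>exp (w * h)\<close> at \<open>h = 0\<close>,
    taken along \<open>h = 1 / n\<close>.\<close>
  have lim: "(\<lambda>n. of_nat n * (exp (w / of_nat n) - 1)) \<longlonglongrightarrow> w" for w :: complex
  proof -
    have "((\<lambda>h. (exp (w * h) - exp (w * 0)) / h) \<longlongrightarrow> w) (at 0)"
    proof -
      have "((\<lambda>h. exp (w * h)) has_field_derivative w) (at 0)"
        by (auto intro!: derivative_eq_intros)
      then show ?thesis by (simp add: has_field_derivative_iff)
    qed
    moreover have "filterlim (\<lambda>n. 1 / of_nat n :: complex) (at 0) sequentially"
      unfolding filterlim_at
      using eventually_gt_at_top[of "0::nat"]
      by (auto intro!: lim_1_over_n elim!: eventually_mono)
    ultimately have "((\<lambda>h. (exp (w * h) - exp (w * 0)) / h) \<circ> (\<lambda>n. 1 / of_nat n)) \<longlonglongrightarrow> w"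
      unfolding o_def by (rule filterlim_compose)
    then show ?thesis
      by (simp add: o_def mult.commute)
  qed
  have "(\<lambda>n. Q (\<lambda>z. of_nat n * (exp (\<psi> z / of_nat n) - 1))) \<longlonglongrightarrow> Q \<psi>"
    unfolding Q_def by (intro tendsto_sum tendsto_mult tendsto_const lim)
  then have "(\<lambda>n. Re (Q (\<lambda>z. of_nat n * (exp (\<psi> z / of_nat n) - 1)))) \<longlonglongrightarrow> Re (Q \<psi>)"
    by (rule tendsto_Re)
  moreover have "eventually (\<lambda>n. 0 \<le> Re (Q (\<lambda>z. of_nat n * (exp (\<psi> z / of_nat n) - 1)))) sequentially"
    using eventually_ge_at_top[of 1] by eventually_elim (rule nonneg)
  ultimately have "0 \<le> Re (Q \<psi>)"
    by (intro tendsto_lowerbound) auto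
  then show ?thesis by (simp add: Q_def)
qed

text \<open>The geometric sum stays bounded by \<open>2 / norm (1 - iexp a)\<close>, so its mean is
  of order \<open>1 / N\<close>.\<close>

lemma iexp_mean_tendsto_zero:
  assumes "iexp a \<noteq> 1"
  shows "(\<lambda>N. (\<Sum>j<N. iexp (real j * a)) / of_nat N) \<longlonglongrightarrow> 0"
proof (rule Lim_null_comparison)
  show "\<forall>\<^sub>F N in sequentially. norm ((\<Sum>j<N. iexp (real j * a)) / of_nat N) \<le> (2 / norm (1 - iexp a)) * (1 / real N)"
  proof (rule always_eventually, rule allI)
    fix N
    have "(\<Sum>j<N. iexp (real j * a)) = (\<Sum>j<N. iexp a ^ j)"
      by (simp add: exp_of_nat_mult[symmetric] algebra_simps)
    also have "\<dots> = (1 - iexp a ^ N) / (1 - iexp a)"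
      using assms by (simp add: sum_gp_strict)
    also have "norm \<dots> \<le> 2 / norm (1 - iexp a)"
      using norm_triangle_ineq4[of 1 "iexp a ^ N"]
      by (auto simp: norm_divide norm_power intro!: divide_right_mono)
    finally have "norm (\<Sum>j<N. iexp (real j * a)) \<le> 2 / norm (1 - iexp a)" .
    from divide_right_mono[OF this, of "real N"]
    show "norm ((\<Sum>j<N. iexp (real j * a)) / of_nat N) \<le> (2 / norm (1 - iexp a)) * (1 / real N)"
      by (simp add: norm_divide)
  qed
  show "(\<lambda>N. (2 / norm (1 - iexp a)) * (1 / real N)) \<longlonglongrightarrow> 0"
    by (intro tendsto_mult_right_zero lim_1_over_n)
qed

lemma norm_integral_le:
  fixes f :: "'a \<Rightarrow> 'b::{banach, second_countable_topology}"
  assumes "integrable M f" "integrable M g" "\<And>x. x \<in> space M \<Longrightarrow> norm (f x) \<le> g x"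
  shows "norm (integral\<^sup>L M f) \<le> integral\<^sup>L M g"
  by (rule order_trans[OF integral_norm_bound integral_mono]) (use assms in auto)

section \<open>Detecting single atoms by trigonometric polynomials\<close>

context jump_sequence
begin

lemma exponent_zero [simp]: "exponent 0 = 0"
  by (simp add: exponent_def)

lemma norm_exponent_diff_le:
  "norm (exponent z - exponent z') \<le> (\<integral>i. \<bar>w i * x i\<bar> \<partial>count_space UNIV) * \<bar>z - z'\<bar>"
proof -
  have "exponent z - exponent z' =
      (\<integral>i. w i *\<^sub>R (iexp (z * x i) - 1) - w i *\<^sub>R (iexp (z' * x i) - 1) \<partial>count_space UNIV)"
    unfolding exponent_def
    by (rule Bochner_Integration.integral_diff[symmetric]) (rule integrable_exponent)+
  also have "\<dots> = (\<integral>i. w i *\<^sub>R (iexp (z * x i) - iexp (z' * x i)) \<partial>count_space UNIV)"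
    by (simp add: algebra_simps)
  also have "norm \<dots> \<le> (\<integral>i. \<bar>w i * x i\<bar> * \<bar>z - z'\<bar> \<partial>count_space UNIV)"
  proof (rule norm_integral_le)
    have "integrable (count_space UNIV)
        (\<lambda>i. w i *\<^sub>R (iexp (z * x i) - 1) - w i *\<^sub>R (iexp (z' * x i) - 1))"
      by (intro Bochner_Integration.integrable_diff integrable_exponent)
    then show "integrable (count_space UNIV) (\<lambda>i. w i *\<^sub>R (iexp (z * x i) - iexp (z' * x i)))"
      by (simp add: algebra_simps)
    show "integrable (count_space UNIV) (\<lambda>i. \<bar>w i * x i\<bar> * \<bar>z - z'\<bar>)"
      using integrable_jumps by simp
    fix i
    have "iexp (z * x i) - iexp (z' * x i) = iexp (z' * x i) * (iexp ((z - z') * x i) - 1)"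
      by (simp add: exp_add[symmetric] algebra_simps)
    then have "norm (iexp (z * x i) - iexp (z' * x i)) \<le> \<bar>(z - z') * x i\<bar>"
      using norm_iexp_minus_one[of "(z - z') * x i"] by (simp add: norm_mult)
    then show "norm (w i *\<^sub>R (iexp (z * x i) - iexp (z' * x i))) \<le> \<bar>w i * x i\<bar> * \<bar>z - z'\<bar>"
      using mult_left_mono[of _ _ "\<bar>w i\<bar>"] by (simp add: abs_mult mult.assoc mult.commute[of "\<bar>x i\<bar>"])
  qed
  finally show ?thesis by simp
qed

lemma norm_exponent_le: "norm (exponent z) \<le> (\<integral>i. \<bar>w i * x i\<bar> \<partial>count_space UNIV) * \<bar>z\<bar>"
  using norm_exponent_diff_le[of z 0] by simp

lemma continuous_on_exponent: "continuous_on A exponent"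
proof (rule lipschitz_on_continuous_on, rule lipschitz_onI)
  show "dist (exponent z) (exponent z') \<le> (\<integral>i. \<bar>w i * x i\<bar> \<partial>count_space UNIV) * dist z z'" for z z'
    using norm_exponent_diff_le by (simp add: dist_norm)
qed simp

text \<open>Since the coefficients sum to 0, both the drift and the terms -1 in the exponent drop
  out of the quadratic form. What remains is the squared modulus of a trigonometric polynomial,
  integrated against the signed measure.\<close>

lemma integral_square_nonneg:
  fixes a :: "'j \<Rightarrow> complex" and t :: "'j \<Rightarrow> real"
  assumes id: "infinitely_divisible \<sigma>"
    and char: "\<And>z. char \<sigma> z = exp (\<i> * of_real (\<gamma> * z) + exponent z)"
    and S: "finite S" and sum: "(\<Sum>j\<in>S. a j) = 0"
  shows "0 \<le> (\<integral>i. w i * (cmod (\<Sum>j\<in>S. a j * iexp (t j * x i)))\<^sup>2 \<partial>count_space UNIV)"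
proof -
  have "0 \<le> Re (\<Sum>j\<in>S. \<Sum>l\<in>S. a j * cnj (a l) * (\<i> * of_real (\<gamma> * (t j - t l)) + exponent (t j - t l)))"
    using id char
    by (rule infinitely_divisible_conditionally_positive)
       (use S sum in \<open>auto intro!: continuous_intros continuous_on_exponent\<close>)
  also have "(\<Sum>j\<in>S. \<Sum>l\<in>S. a j * cnj (a l) * (\<i> * of_real (\<gamma> * (t j - t l)) + exponent (t j - t l))) =
      \<i> * of_real \<gamma> * (\<Sum>j\<in>S. \<Sum>l\<in>S. a j * cnj (a l) * (of_real (t j) - of_real (t l))) +
      (\<Sum>j\<in>S. \<Sum>l\<in>S. a j * cnj (a l) * exponent (t j - t l))"
    by (simp add: sum_distrib_left sum.distrib[symmetric] algebra_simps)
  also have "(\<Sum>j\<in>S. \<Sum>l\<in>S. a j * cnj (a l) * (of_real (t j) - of_real (t l))) =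
     (\<Sum>j\<in>S. a j * of_real (t j)) * cnj (\<Sum>l\<in>S. a l) - (\<Sum>j\<in>S. a j) * (\<Sum>l\<in>S. cnj (a l) * of_real (t l))"
    unfolding cnj_sum sum_product by (simp add: sum_subtractf[symmetric] right_diff_distrib mult_ac)
  also have "\<dots> = 0" using sum by (simp flip: cnj_sum)
  also have "(\<Sum>j\<in>S. \<Sum>l\<in>S. a j * cnj (a l) * exponent (t j - t l)) =
     (\<integral>i. (\<Sum>j\<in>S. \<Sum>l\<in>S. a j * cnj (a l) * (w i *\<^sub>R (iexp ((t j - t l) * x i) - 1))) \<partial>count_space UNIV)"
    unfolding exponent_def
    by (simp only: Bochner_Integration.integral_sum Bochner_Integration.integrable_sum
          integrable_mult_right integrable_exponent integral_mult_right_zero)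
  also have "\<dots> = (\<integral>i. of_real (w i * (cmod (\<Sum>j\<in>S. a j * iexp (t j * x i)))\<^sup>2) \<partial>count_space UNIV)"
  proof (rule Bochner_Integration.integral_cong)
    fix i
    have "(\<Sum>j\<in>S. \<Sum>l\<in>S. a j * cnj (a l) * (w i *\<^sub>R (iexp ((t j - t l) * x i) - 1))) =
       of_real (w i) * ((\<Sum>j\<in>S. \<Sum>l\<in>S. a j * cnj (a l) * iexp ((t j - t l) * x i)) -
         (\<Sum>j\<in>S. \<Sum>l\<in>S. a j * cnj (a l)))"
      by (simp add: sum_distrib_left sum_subtractf[symmetric] scaleR_conv_of_real algebra_simps)
    also have "(\<Sum>j\<in>S. \<Sum>l\<in>S. a j * cnj (a l)) = 0"
      using sum by (simp add: sum_product[symmetric])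
    also have "(\<Sum>j\<in>S. \<Sum>l\<in>S. a j * cnj (a l) * iexp ((t j - t l) * x i)) =
        (\<Sum>j\<in>S. a j * iexp (t j * x i)) * cnj (\<Sum>l\<in>S. a l * iexp (t l * x i))"
      by (simp add: sum_product exp_cnj exp_diff exp_minus divide_inverse algebra_simps)
    also have "\<dots> = of_real ((cmod (\<Sum>j\<in>S. a j * iexp (t j * x i)))\<^sup>2)"
      by (rule complex_norm_square[symmetric])
    finally show "(\<Sum>j\<in>S. \<Sum>l\<in>S. a j * cnj (a l) * (w i *\<^sub>R (iexp ((t j - t l) * x i) - 1))) =
       of_real (w i * (cmod (\<Sum>j\<in>S. a j * iexp (t j * x i)))\<^sup>2)"
      by simp
  qed simp
  also have "\<dots> = of_real (\<integral>i. w i * (cmod (\<Sum>j\<in>S. a j * iexp (t j * x i)))\<^sup>2 \<partial>count_space UNIV)"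
    by (rule integral_complex_of_real)
  finally show ?thesis by simp
qed

text \<open>
  The trigonometric polynomials \<open>(iexp (\<theta> y) - 1) \<cdot> (\<Sum>j<N. iexp (j \<eta> (y - x0))) / N\<close> vanish at
  \<open>y = 0\<close> and, for \<open>\<eta>\<close> outside a countable set, tend to 0 at all jumps except \<open>x0\<close>.
\<close>

lemma infinitely_divisible_imp_mass_nonneg:
  assumes id: "infinitely_divisible \<sigma>"
    and char: "\<And>z. char \<sigma> z = exp (\<i> * of_real (\<gamma> * z) + exponent z)"
    and "x0 \<noteq> 0"
  shows "0 \<le> mass x0"
proof -
  \<comment> \<open>The frequencies at which some other jump is in phase with \<open>x0\<close>.
    There are countably many indices, so \<open>E\<close> is countable and misses some real
    number.\<close>
  define E where "E = (\<Union>i\<in>{i. x i \<noteq> x0}. range (\<lambda>n::int. of_int (2 * n) * pi / (x i - x0)))"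
  have "countable E" unfolding E_def by (intro countable_UN countable_image) auto
  then have "E \<noteq> UNIV" using uncountable_UNIV_real by metis
  then obtain \<eta> where \<eta>: "\<eta> \<notin> E" by auto
  have ne: "iexp (\<eta> * (x i - x0)) \<noteq> 1" if "x i \<noteq> x0" for i
  proof
    assume "iexp (\<eta> * (x i - x0)) = 1"
    then obtain n :: int where "\<eta> * (x i - x0) = of_int (2 * n) * pi"
      by (auto simp: exp_eq_1)
    then have "\<eta> = of_int (2 * n) * pi / (x i - x0)" using that by (simp add: field_simps)
    then show False using \<eta> that unfolding E_def by blast
  qed
  \<comment> \<open>This makes the first factor of the polynomial equal to -2 at \<open>x0\<close>,
    which is the source of the factor 4 in the limit.\<close>
  define \<theta> where "\<theta> = pi / x0"
  define P where "P N y = (iexp (\<theta> * y) - 1) * ((\<Sum>j<N. iexp (real j * (\<eta> * (y - x0)))) / of_nat N)"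
    for N y
  define a where "a N = (\<lambda>(b, j). (if b then 1 else -1) * iexp (- (real j * \<eta> * x0)) / of_nat N)"
    for N :: nat
  define t where "t = (\<lambda>(b, j). (if b then \<theta> else 0) + real j * \<eta>)"
  have P_eq: "(\<Sum>j\<in>UNIV \<times> {..<N}. a N j * iexp (t j * y)) = P N y" for N y
  proof -
    have "(\<Sum>j\<in>UNIV \<times> {..<N}. a N j * iexp (t j * y)) =
       (\<Sum>b\<in>UNIV. \<Sum>j<N. a N (b, j) * iexp (t (b, j) * y))"
      by (simp add: sum.cartesian_product)
    also have "\<dots> = P N y"
      unfolding P_def a_def t_def
      by (simp add: UNIV_bool sum_divide_distrib sum_distrib_left sum_subtractf[symmetric]
            sum.distrib[symmetric] diff_divide_distrib exp_add[symmetric] algebra_simps flip: exp_minus)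
    finally show ?thesis .
  qed
  have nn: "0 \<le> (\<integral>i. w i * (cmod (P N (x i)))\<^sup>2 \<partial>count_space UNIV)" for N
  proof -
    have "(\<Sum>j\<in>UNIV \<times> {..<N}. a N j) = P N 0" using P_eq[of N 0] by simp
    also have "\<dots> = 0" by (simp add: P_def)
    finally show ?thesis
      using integral_square_nonneg[OF id char, of "UNIV \<times> {..<N}" "a N" t]
      by (simp only: P_eq) simp
  qed
  have mean: "norm ((\<Sum>j<N. iexp (real j * b)) / of_nat N) \<le> 1" for N b
  proof -
    have "norm (\<Sum>j<N. iexp (real j * b)) \<le> (\<Sum>j<N. 1)"
      by (rule sum_norm_le) simp
    then show ?thesis by (cases "N = 0") (auto simp: norm_divide divide_simps)
  qed
  \<comment> \<open>One of the two factors is estimated by 2 and the other linearly, so that the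
    first moment provides a dominating function.\<close>
  have bound: "(cmod (P N y))\<^sup>2 \<le> (2 * \<bar>\<theta>\<bar>) * \<bar>y\<bar>" for N y
  proof -
    have "cmod (P N y) \<le> cmod (iexp (\<theta> * y) - 1)"
      unfolding P_def norm_mult by (rule order_trans[OF mult_left_mono[OF mean]]) simp_all
    moreover have "cmod (iexp (\<theta> * y) - 1) \<le> 2" using norm_triangle_ineq4[of "iexp (\<theta> * y)" 1] by simp
    moreover have "cmod (iexp (\<theta> * y) - 1) \<le> \<bar>\<theta>\<bar> * \<bar>y\<bar>"
      using norm_iexp_minus_one[of "\<theta> * y"] by (simp add: abs_mult)
    ultimately have "cmod (P N y) * cmod (P N y) \<le> 2 * (\<bar>\<theta>\<bar> * \<bar>y\<bar>)"
      by (intro mult_mono) auto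
    then show ?thesis by (simp add: power2_eq_square)
  qed
  have lim: "(\<lambda>N. (cmod (P N (x i)))\<^sup>2) \<longlonglongrightarrow> 4 * indicator {i. x i = x0} i" for i
  proof (cases "x i = x0")
    case True
    have P: "P N (x i) = -2" if "N > 0" for N
      using that True \<open>x0 \<noteq> 0\<close> by (simp add: P_def \<theta>_def)
    have "eventually (\<lambda>N. (cmod (P N (x i)))\<^sup>2 = 4) sequentially"
      using eventually_gt_at_top[of 0] by (rule eventually_mono) (simp add: P)
    then show ?thesis using True by (simp add: tendsto_eventually)
  next
    case False
    have "(\<lambda>N. P N (x i)) \<longlonglongrightarrow> (iexp (\<theta> * x i) - 1) * 0"
      unfolding P_def by (intro tendsto_mult tendsto_const iexp_mean_tendsto_zero ne False)
    then have "(\<lambda>N. (cmod (P N (x i)))\<^sup>2) \<longlonglongrightarrow> (cmod ((iexp (\<theta> * x i) - 1) * 0))\<^sup>2"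
      by (intro tendsto_power tendsto_norm)
    then show ?thesis using False by simp
  qed
  have "(\<lambda>N. \<integral>i. w i * (cmod (P N (x i)))\<^sup>2 \<partial>count_space UNIV) \<longlonglongrightarrow>
      (\<integral>i. w i * (4 * indicator {i. x i = x0} i) \<partial>count_space UNIV)"
  proof (rule integral_dominated_convergence[where w = "\<lambda>i. \<bar>w i * x i\<bar> * (2 * \<bar>\<theta>\<bar>)"])
    show "integrable (count_space UNIV) (\<lambda>i. \<bar>w i * x i\<bar> * (2 * \<bar>\<theta>\<bar>))"
      using integrable_jumps by simp
    show "AE i in count_space UNIV. (\<lambda>N. w i * (cmod (P N (x i)))\<^sup>2) \<longlonglongrightarrow> w i * (4 * indicator {i. x i = x0} i)"
      by (intro AE_I2 tendsto_mult tendsto_const lim)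
    show "AE i in count_space UNIV. norm (w i * (cmod (P N (x i)))\<^sup>2) \<le> \<bar>w i * x i\<bar> * (2 * \<bar>\<theta>\<bar>)" for N
    proof (rule AE_I2)
      fix i
      show "norm (w i * (cmod (P N (x i)))\<^sup>2) \<le> \<bar>w i * x i\<bar> * (2 * \<bar>\<theta>\<bar>)"
        using mult_left_mono[OF bound[of N "x i"], of "\<bar>w i\<bar>"] by (simp add: abs_mult algebra_simps)
    qed
  qed auto
  then have "0 \<le> (\<integral>i. w i * (4 * indicator {i. x i = x0} i) \<partial>count_space UNIV)"
    by (rule tendsto_lowerbound) (auto intro: always_eventually nn)
  also have "\<dots> = (\<integral>i. 4 * (w i * indicator {i. x i = x0} i) \<partial>count_space UNIV)"
    by (simp add: algebra_simps)
  also have "\<dots> = 4 * mass x0"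
    by (simp only: integral_mult_right_zero mass_def)
  finally show ?thesis by simp
qed

end

subsection \<open>The candidate for the characteristic function\<close>

lemma integrable_count_space_prod:
  fixes f :: "'a::countable \<Rightarrow> 'b::countable \<Rightarrow> real"
  assumes "\<And>a. integrable (count_space UNIV) (f a)"
    and "integrable (count_space UNIV) (\<lambda>a. \<integral>b. \<bar>f a b\<bar> \<partial>count_space UNIV)"
  shows "integrable (count_space UNIV) (\<lambda>(a, b). f a b)"
proof -
  interpret pair_sigma_finite "count_space (UNIV :: 'a set)" "count_space (UNIV :: 'b set)"
    by (simp add: pair_sigma_finite_def sigma_finite_measure_count_space_countable)
  have prod: "count_space (UNIV :: 'a set) \<Otimes>\<^sub>M count_space (UNIV :: 'b set) = count_space UNIV"
    by (simp add: pair_measure_countable)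
  have "integrable (count_space UNIV \<Otimes>\<^sub>M count_space UNIV) (\<lambda>(a, b). f a b)"
    by (rule Fubini_integrable) (use assms in \<open>auto simp: prod\<close>)
  then show ?thesis by (simp add: prod)
qed

lemma integral_count_space_prod:
  fixes f :: "'a::countable \<Rightarrow> 'b::countable \<Rightarrow> 'c::{banach, second_countable_topology}"
  assumes "integrable (count_space UNIV) (\<lambda>(a, b). f a b)"
  shows "integrable (count_space UNIV) (\<lambda>a. \<integral>b. f a b \<partial>count_space UNIV)"
    and "(\<integral>x. (case x of (a, b) \<Rightarrow> f a b) \<partial>count_space UNIV) =
      (\<integral>a. (\<integral>b. f a b \<partial>count_space UNIV) \<partial>count_space UNIV)"
proof -
  interpret pair_sigma_finite "count_space (UNIV :: 'a set)" "count_space (UNIV :: 'b set)"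
    by (simp add: pair_sigma_finite_def sigma_finite_measure_count_space_countable)
  have prod: "count_space (UNIV :: 'a set) \<Otimes>\<^sub>M count_space (UNIV :: 'b set) = count_space UNIV"
    by (simp add: pair_measure_countable)
  show "integrable (count_space UNIV) (\<lambda>a. \<integral>b. f a b \<partial>count_space UNIV)"
    using integrable_fst[of f] assms by (simp add: prod)
  show "(\<integral>x. (case x of (a, b) \<Rightarrow> f a b) \<partial>count_space UNIV) =
      (\<integral>a. (\<integral>b. f a b \<partial>count_space UNIV) \<partial>count_space UNIV)"
    using integral_fst[of f] assms by (simp add: prod)
qed

text \<open>
  If \<open>w\<close> and \<open>x\<close> describe a distribution \<open>\<rho>\<close>, then the scaled copies describe the \<open>c\<inverse>\<close>-decomposable
  distribution with factor \<open>\<rho>\<close>.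
\<close>

lemma (in jump_sequence) scaled_copies:
  assumes "c > 1"
  shows "jump_sequence (\<lambda>(n::nat, i). w i) (\<lambda>(n, i). x i / c ^ n)"
    and "jump_sequence.exponent (\<lambda>(n::nat, i). w i) (\<lambda>(n, i). x i / c ^ n) z =
      exponent z + jump_sequence.exponent (\<lambda>(n::nat, i). w i) (\<lambda>(n, i). x i / c ^ n) (z / c)"
proof -
  let ?w = "\<lambda>(n::nat, i). w i" and ?x = "\<lambda>(n, i). x i / c ^ n"
  have geo: "summable (\<lambda>n. b / c ^ n)" for b
    using assms summable_mult[OF summable_geometric[of "1 / c"], of b] by (simp add: power_divide)
  have "integrable (count_space UNIV) (\<lambda>(n::nat, i). w i * x i / c ^ n)"
  proof (rule integrable_count_space_prod)
    show "integrable (count_space UNIV) (\<lambda>i. w i * x i / c ^ n)" for n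
      using integrable_jumps by simp
    have "(\<integral>i. \<bar>w i * x i / c ^ n\<bar> \<partial>count_space UNIV) = (\<integral>i. \<bar>w i * x i\<bar> \<partial>count_space UNIV) / c ^ n" for n
      using assms by simp
    then show "integrable (count_space UNIV) (\<lambda>n. \<integral>i. \<bar>w i * x i / c ^ n\<bar> \<partial>count_space UNIV)"
      using assms geo
      by (simp add: integrable_count_space_nat_iff)
  qed
  then show js: "jump_sequence ?w ?x"
    unfolding jump_sequence_def by (simp add: split_beta')
  interpret S: jump_sequence ?w ?x by fact
  have int: "integrable (count_space UNIV) (\<lambda>(n, i). w i *\<^sub>R (iexp (z / c ^ n * x i) - 1))" for z
    using S.integrable_exponent[of z] by (simp add: split_beta')
  have S_eq: "S.exponent z = (\<integral>n. exponent (z / c ^ n) \<partial>count_space UNIV)" for z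
    using integral_count_space_prod(2)[OF int[of z]]
    by (simp add: S.exponent_def exponent_def split_beta)
  have sums: "(\<lambda>n. exponent (z / c ^ n)) sums S.exponent z" for z
    using integral_count_space_prod(1)[OF int[of z]] unfolding S_eq exponent_def
    by (rule sums_integral_count_space_nat)
  have "(\<lambda>n. exponent (z / c ^ Suc n)) sums S.exponent (z / c)"
    using sums[of "z / c"] by simp
  then have "(\<lambda>n. exponent (z / c ^ n)) sums (S.exponent (z / c) + exponent (z / c ^ 0))"
    by (rule sums_Suc)
  then show "S.exponent z = exponent z + S.exponent (z / c)"
    using sums_unique2[OF sums[of z]] by simp
qed

text \<open>The coefficient of \<open>x ^ Suc m\<close> in \<open>ln (1 + a * x)\<close>;
  \<open>m = 0\<close> is the linear term.\<close>

definition log_weight :: "real \<Rightarrow> nat \<Rightarrow> real" where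
  "log_weight a m = (- 1) ^ m * a ^ Suc m / Suc m"

text \<open>The summand is the difference of the series of \<open>ln (1 + a * u)\<close> at
  \<open>u = iexp t\<close> and at \<open>u = 1\<close>; the second one yields the
  denominator.\<close>

lemma exp_log_weight_sums:
  assumes "\<bar>a\<bar> < 1" and "(\<lambda>m. log_weight a m *\<^sub>R (iexp (t * real (Suc m)) - 1)) sums \<zeta>"
  shows "exp \<zeta> = (1 + of_real a * iexp t) / (1 + of_real a)"
proof -
  have series: "(\<lambda>m. of_real (log_weight a m) * u ^ Suc m) sums ln (1 + a * u)"
    if "norm u = 1" for u :: complex
  proof -
    have "(\<lambda>n. (-1) ^ Suc n / of_nat n * (a * u) ^ n) sums ln (1 + a * u)"
      by (rule Ln_series) (use assms that in \<open>simp add: norm_mult\<close>)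
    then have "(\<lambda>n. (-1) ^ Suc (Suc n) / of_nat (Suc n) * (a * u) ^ Suc n) sums ln (1 + a * u)"
      by (subst sums_Suc_iff) simp
    then show ?thesis
      by (simp add: log_weight_def power_mult_distrib mult_ac)
  qed
  have "(\<lambda>m. of_real (log_weight a m) * iexp t ^ Suc m - of_real (log_weight a m) * 1 ^ Suc m) sums
     (ln (1 + of_real a * iexp t) - ln (1 + of_real a * (1 :: complex)))"
    by (intro sums_diff series) auto
  moreover have "iexp t ^ Suc m = iexp (t * real (Suc m))" for m
    unfolding exp_of_nat_mult[symmetric] by (simp add: algebra_simps)
  ultimately have "(\<lambda>m. log_weight a m *\<^sub>R (iexp (t * real (Suc m)) - 1)) sums
     (ln (1 + of_real a * iexp t) - ln (1 + of_real a :: complex))"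
    by (simp add: scaleR_conv_of_real right_diff_distrib)
  then have "\<zeta> = ln (1 + of_real a * iexp t) - ln (1 + of_real a)"
    using assms(2) sums_unique2 by blast
  moreover have ne: "1 + a * u \<noteq> 0" if "norm u = 1" for u :: complex
  proof
    assume "1 + a * u = 0"
    then have "norm (of_real a * u) = norm (-1 :: complex)" by (metis add_eq_0_iff)
    then show False using that assms(1) by (simp add: norm_mult)
  qed
  ultimately show ?thesis
    using ne[of "iexp t"] ne[of 1] by (simp add: exp_diff)
qed

text \<open>Raising the two equations to the powers l and n eliminates c and leaves
  \<open>a ^ l * 2 ^ n = b ^ n * 2 ^ l\<close> in the integers. As a and b are odd, the exponents of
  2 must agree.\<close>

lemma odd_power_relation_unique:
  fixes c :: real
  assumes "c > 1" and a: "odd a" "real a = 2 * c ^ n" and b: "odd b" "real b = 2 * c ^ l"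
  shows "n = l"
proof -
  have *: "n \<ge> l" if a: "odd a" "real a = 2 * c ^ n" and b: "odd b" "real b = 2 * c ^ l" for a b n l
  proof (rule ccontr)
    assume "\<not> n \<ge> l"
    have "real (a ^ l * 2 ^ n) = real (b ^ n * 2 ^ l)"
      using a b by (simp add: power_mult_distrib power_mult[symmetric] mult.commute)
    then have "a ^ l * 2 ^ n = b ^ n * 2 ^ l" using of_nat_eq_iff by blast
    also have "(2::nat) ^ l = 2 ^ (l - n) * 2 ^ n"
      using \<open>\<not> n \<ge> l\<close> by (simp add: power_add[symmetric])
    finally have "a ^ l = b ^ n * 2 ^ (l - n)" by simp
    then have "even (a ^ l)" using \<open>\<not> n \<ge> l\<close> by simp
    then show False using a by simp
  qed
  show ?thesis using *[OF a b] *[OF b a] by simp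
qed


section \<open>The solution of the functional equation\<close>

locale law_parameters =
  fixes c p q r :: real and k :: int
  assumes c: "c > 1" and p: "p > 0" and q: "q \<ge> 0" and r: "r > 0"
    and sum_one: "p + q + r = 1" and p_neq_r: "p \<noteq> r"
begin

definition \<kappa> :: real where "\<kappa> = c powi (- k)"

text \<open>
  The logarithm of \<open>p + r iexp (\<kappa> z)\<close> is expanded in powers of \<open>(r / p) iexp (\<kappa> z)\<close> if \<open>r < p\<close>.
  Otherwise \<open>r iexp (\<kappa> z)\<close> is factored out, which produces the drift, and the expansion is in
  powers of \<open>(p / r) iexp (- \<kappa> z)\<close>.
\<close>

definition s :: real where "s = (if r < p then r / p else p / r)"

definition \<epsilon> :: real where "\<epsilon> = (if r < p then 1 else -1)"

text \<open>\<open>True\<close> marks the series of \<open>p + r iexp (\<kappa> z)\<close>,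
  \<open>False\<close> that of the reciprocal of \<open>1 - q iexp z\<close>. In the latter the two
  signs cancel and the weights are \<open>q ^ Suc m / Suc m\<close>, so negative weights occur only
  for \<open>True\<close>.\<close>

definition factor_weight :: "bool \<times> nat \<Rightarrow> real" where
  "factor_weight = (\<lambda>(b, m). if b then log_weight s m else - log_weight (- q) m)"

definition factor_jump :: "bool \<times> nat \<Rightarrow> real" where
  "factor_jump = (\<lambda>(b, m). (if b then \<epsilon> * \<kappa> else 1) * real (Suc m))"

lemma \<kappa>_pos: "\<kappa> > 0"
  using c by (simp add: \<kappa>_def)

lemma s_pos: "s > 0" and s_less_one: "s < 1"
  using p r p_neq_r by (auto simp: s_def)

lemma q_less_one: "q < 1"
  using p r sum_one by simp

lemma \<epsilon>_squared: "\<epsilon> * \<epsilon> = 1" "\<bar>\<epsilon>\<bar> = 1" "\<epsilon> \<noteq> 0"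
  by (auto simp: \<epsilon>_def)

text \<open>The denominator of the logarithmic coefficient cancels against the multiple in the jump,
  so the first moment is a sum of geometric series.\<close>

lemma abs_factor_weight_mult_jump:
  "\<bar>factor_weight (b, m) * factor_jump (b, m)\<bar> = (if b then \<kappa> * s ^ Suc m else q ^ Suc m)"
  using s_pos q \<kappa>_pos \<epsilon>_squared
  by (simp add: factor_weight_def factor_jump_def log_weight_def abs_mult power_abs del: of_nat_Suc)

sublocale factor: jump_sequence factor_weight factor_jump
proof
  have geo: "summable (\<lambda>m. a ^ Suc m)" if "0 \<le> a" "a < 1" for a :: real
    using that by (simp add: summable_Suc_iff summable_geometric)
  have "integrable (count_space UNIV) (\<lambda>(b, m). factor_weight (b, m) * factor_jump (b, m))"
  proof (rule integrable_count_space_prod)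
    show "integrable (count_space UNIV) (\<lambda>m. factor_weight (b, m) * factor_jump (b, m))" for b
      unfolding integrable_count_space_nat_iff real_norm_def abs_factor_weight_mult_jump
      using geo[of s] geo[of q] s_pos s_less_one q q_less_one
      by (cases b) (auto intro!: summable_mult simp del: power_Suc)
  qed (simp add: integrable_count_space)
  then show "integrable (count_space UNIV) (\<lambda>i. factor_weight i * factor_jump i)"
    by (simp add: split_beta')
qed

lemma exp_factor_exponent:
  "(1 - q * iexp z) * exp (factor.exponent z) =
     (1 - of_real q) * ((1 + of_real s * iexp (z * (\<epsilon> * \<kappa>))) / (1 + of_real s))"
proof -
  define h where "h b m = factor_weight (b, m) *\<^sub>R (iexp (z * factor_jump (b, m)) - 1)" for b m
  have int: "integrable (count_space UNIV) (\<lambda>(b, m). h b m)"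
    using factor.integrable_exponent[of z] by (simp add: h_def split_beta')
  have int_b: "integrable (count_space UNIV) (h b)" for b
  proof -
    interpret pair_sigma_finite "count_space (UNIV :: bool set)" "count_space (UNIV :: nat set)"
      by (simp add: pair_sigma_finite_def sigma_finite_measure_count_space_countable)
    have "AE b in count_space UNIV. integrable (count_space UNIV) (h b)"
      using AE_integrable_fst[of h] int by (simp add: pair_measure_countable)
    then show ?thesis by (simp add: AE_count_space)
  qed
  define I where "I b = (\<integral>m. h b m \<partial>count_space UNIV)" for b
  have sums: "h b sums I b" for b
    unfolding I_def by (rule sums_integral_count_space_nat[OF int_b])
  have "factor.exponent z = (\<integral>b. I b \<partial>count_space UNIV)"
    using integral_count_space_prod(2)[OF int]
    by (simp add: factor.exponent_def h_def I_def split_beta')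
  also have "\<dots> = I True + I False"
    by (simp add: lebesgue_integral_count_space_finite UNIV_bool)
  finally have e: "exp (factor.exponent z) = exp (I True) * exp (I False)"
    by (simp add: exp_add)
  have "exp (I True) = (1 + of_real s * iexp (z * (\<epsilon> * \<kappa>))) / (1 + of_real s)"
    by (rule exp_log_weight_sums)
       (use s_pos s_less_one sums[of True] in \<open>auto simp: h_def[abs_def] factor_weight_def factor_jump_def mult.assoc\<close>)
  moreover have "exp (- I False) = (1 + of_real (- q) * iexp z) / (1 + of_real (- q))"
  proof (rule exp_log_weight_sums)
    show "(\<lambda>m. log_weight (- q) m *\<^sub>R (iexp (z * real (Suc m)) - 1)) sums - I False"
      using sums_minus[OF sums[of False]] by (simp add: h_def factor_weight_def factor_jump_def)
  qed (use q q_less_one in auto)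
  moreover have "1 - of_real q \<noteq> (0::complex)"
    using q_less_one by (metis less_irrefl of_real_1 of_real_eq_iff right_minus_eq)
  ultimately have "exp (I True) = (1 + of_real s * iexp (z * (\<epsilon> * \<kappa>))) / (1 + of_real s)"
    and "(1 - q * iexp z) = (1 - of_real q) * exp (- I False)"
    by auto
  then show ?thesis
    by (simp add: e exp_minus)
qed

text \<open>The sum of the geometric series \<open>\<kappa> / c ^ n\<close>: each scaled copy
  contributes the exponential that was factored out.\<close>

definition drift :: real where "drift = (if r < p then 0 else \<kappa> * c / (c - 1))"

definition weight :: "nat \<times> bool \<times> nat \<Rightarrow> real" where
  "weight = (\<lambda>(n, i). factor_weight i)"

definition jump :: "nat \<times> bool \<times> nat \<Rightarrow> real" where
  "jump = (\<lambda>(n, i). factor_jump i / c ^ n)"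

sublocale jump_sequence weight jump
  unfolding weight_def jump_def by (rule factor.scaled_copies(1)[OF c])

definition law_char :: "real \<Rightarrow> complex" where
  "law_char z = exp (\<i> * of_real (drift * z) + exponent z)"

lemma law_char_functional_equation:
  "(1 - q * iexp z) * law_char z = (p + r * iexp (\<kappa> * z)) * law_char (z / c)"
proof -
  have ex: "exponent z = factor.exponent z + exponent (z / c)"
    using factor.scaled_copies(2)[OF c, of z] unfolding weight_def jump_def .
  \<comment> \<open>The drift of a single factor; \<open>drift\<close> is the fixed point of adding
    \<open>d\<close> after division by c.\<close>
  define d where "d = (if r < p then 0 else \<kappa>)"
  have dr: "drift * z = d * z + drift * (z / c)"
    using c by (simp add: drift_def d_def field_simps)
  have "law_char z = iexp (d * z) * exp (factor.exponent z) * law_char (z / c)"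
    unfolding law_char_def dr ex by (simp add: exp_add[symmetric] algebra_simps)
  moreover have q_eq: "1 - of_real q = (of_real p + of_real r :: complex)"
  proof -
    have "1 - q = p + r" using sum_one by simp
    then show ?thesis by (metis of_real_1 of_real_add of_real_diff)
  qed
  moreover have ratio: "(P + R) * ((1 + R / P * E) / (1 + R / P)) = P + R * E"
    if "P \<noteq> 0" "P + R \<noteq> 0" for P R E :: complex
  proof -
    have "1 + R / P = (P + R) / P" "1 + R / P * E = (P + R * E) / P"
      using that by (simp_all add: field_simps)
    then show ?thesis using that by simp
  qed
  moreover have "iexp (d * z) * ((1 - q * iexp z) * exp (factor.exponent z)) = p + r * iexp (\<kappa> * z)"
  proof (cases "r < p")
    case True
    note q_eq
    moreover have "of_real p \<noteq> (0::complex)" "of_real p + of_real r \<noteq> (0::complex)"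
      using p r by (auto simp flip: of_real_add)
    ultimately show ?thesis
      unfolding exp_factor_exponent q_eq mult.commute[of \<kappa>]
      using True ratio[of "of_real p" "of_real r" "iexp (z * \<kappa>)"]
      by (simp add: d_def s_def \<epsilon>_def)
  next
    case False
    note q_eq
    moreover have "of_real r \<noteq> (0::complex)" "of_real p + of_real r \<noteq> (0::complex)"
      using p r by (auto simp flip: of_real_add)
    ultimately have *: "(of_real p + of_real r) * ((1 + of_real p / of_real r * inverse (iexp (\<kappa> * z))) /
        (1 + of_real p / of_real r)) = of_real r + of_real p * inverse (iexp (\<kappa> * z))"
      using ratio[of "of_real r" "of_real p" "inverse (iexp (\<kappa> * z))"]
      by (simp only: add.commute[of "of_real p"] not_False_eq_True)
    have e: "iexp (z * (\<epsilon> * \<kappa>)) = inverse (iexp (\<kappa> * z))"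
      using False by (simp add: \<epsilon>_def mult.commute flip: exp_minus)
    have s: "of_real s = (of_real p / of_real r :: complex)" and d: "d = \<kappa>"
      using False by (simp_all add: s_def d_def)
    show ?thesis
      unfolding exp_factor_exponent q_eq e s d * by (simp add: distrib_left)
  qed
  ultimately have "(p + r * iexp (\<kappa> * z)) * law_char (z / c) =
      iexp (d * z) * ((1 - q * iexp z) * exp (factor.exponent z)) * law_char (z / c)"
    and "law_char z = iexp (d * z) * exp (factor.exponent z) * law_char (z / c)"
    by simp_all
  then show ?thesis by (simp only: mult_ac)
qed

text \<open>The argument will be \<open>c powr (- N) * z\<close> with N the counting process at a
  late time. A linear rate at 0 turns the distance from 1 into the mean of
  \<open>c powr (- N)\<close>.\<close>

lemma law_char_near_zero: "\<exists>C\<ge>0. \<forall>z. \<bar>z\<bar> \<le> R \<longrightarrow> norm (law_char z - 1) \<le> C * \<bar>z\<bar>"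
proof -
  define B where "B = \<bar>drift\<bar> + (\<integral>i. \<bar>weight i * jump i\<bar> \<partial>count_space UNIV)"
  have B: "B \<ge> 0" by (simp add: B_def)
  have "norm (law_char z - 1) \<le> (B * exp (B * \<bar>R\<bar>)) * \<bar>z\<bar>" if "\<bar>z\<bar> \<le> R" for z
  proof -
    let ?\<psi> = "\<i> * of_real (drift * z) + exponent z"
    have "norm ?\<psi> \<le> norm (\<i> * of_real (drift * z)) + norm (exponent z)"
      by (rule norm_triangle_ineq)
    also have "\<dots> \<le> B * \<bar>z\<bar>"
      using norm_exponent_le[of z] by (simp add: B_def norm_mult abs_mult distrib_right)
    finally have \<psi>: "norm ?\<psi> \<le> B * \<bar>z\<bar>" .
    have "norm (exp ?\<psi> - 1) \<le> norm ?\<psi> * exp (norm ?\<psi>)"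
      using Taylor_exp_field[of ?\<psi> 0] by (simp add: mult.commute)
    also have "\<dots> \<le> (B * \<bar>z\<bar>) * exp (B * \<bar>R\<bar>)"
      using \<psi> order_trans[OF \<psi> mult_left_mono[of "\<bar>z\<bar>" "\<bar>R\<bar>" B]] that B by (intro mult_mono) auto
    finally show ?thesis by (simp add: law_char_def algebra_simps)
  qed
  then show ?thesis using B by (intro exI[of _ "B * exp (B * \<bar>R\<bar>)"]) auto
qed

lemma continuous_on_law_char: "continuous_on A law_char"
  unfolding law_char_def by (intro continuous_intros continuous_on_exponent)

end

section \<open>A negative atom for large \<kappa>\<close>

context law_parameters
begin

text \<open>The part of the first absolute moment carried by the jumps with \<open>\<not> b\<close>.
  Only c and q enter, so the threshold for k can be chosen from it.\<close>

definition geometric_mass :: real where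
  "geometric_mass = (\<integral>i. (case i of (n, b, m) \<Rightarrow> if b then 0 else q ^ Suc m / c ^ n)
     \<partial>count_space (UNIV :: (nat \<times> bool \<times> nat) set))"

lemma abs_weight_mult_jump:
  "\<bar>weight (n, b, m) * jump (n, b, m)\<bar> = (if b then \<kappa> * s ^ Suc m else q ^ Suc m) / c ^ n"
  using abs_factor_weight_mult_jump[of b m] c by (simp add: weight_def jump_def abs_mult del: power_Suc)

lemma integrable_geometric_mass:
  "integrable (count_space (UNIV :: (nat \<times> bool \<times> nat) set))
     (\<lambda>(n, b, m). if b then 0 else q ^ Suc m / c ^ n)"
proof (rule Bochner_Integration.integrable_bound[OF integrable_jumps])
  show "AE i in count_space UNIV. norm (case i of (n, b, m) \<Rightarrow> if b then 0 else q ^ Suc m / c ^ n)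
      \<le> norm (weight i * jump i)"
  proof (rule AE_I2)
    fix i :: "nat \<times> bool \<times> nat"
    obtain n b m where i: "i = (n, b, m)" by (cases i) auto
    show "norm (case i of (n, b, m) \<Rightarrow> if b then 0 else q ^ Suc m / c ^ n) \<le> norm (weight i * jump i)"
      unfolding i real_norm_def abs_weight_mult_jump using q c s_pos \<kappa>_pos by (auto simp: abs_mult)
  qed
qed simp

text \<open>
  At the point \<open>2 \<epsilon> \<kappa>\<close> the second term of the logarithmic series contributes \<open>- s\<^sup>2 / 2\<close>.  A positive
  contribution of that series comes from an odd multiple \<open>Suc m = 2 c\<^sup>n \<ge> 3\<close>, and there is at most
  one such multiple.  The jumps with \<open>\<not> b\<close> are controlled by Markov's inequality, with the bound
  \<open>geometric_mass\<close> that does not depend on \<open>k\<close>.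
\<close>

lemma mass_le: "mass (2 * \<epsilon> * \<kappa>) \<le> - (s\<^sup>2 / 2) + s ^ 3 / 3 + geometric_mass / (2 * \<kappa>)"
proof -
  let ?x0 = "2 * \<epsilon> * \<kappa>"
  \<comment> \<open>The second term of the series in the unscaled copy.\<close>
  define i0 :: "nat \<times> bool \<times> nat" where "i0 = (0, True, 1)"
  \<comment> \<open>\<open>even m\<close> means an odd multiple \<open>Suc m\<close>: these are the
    positive terms of the series at the point \<open>?x0\<close>.\<close>
  define J where "J = {(n, b, m) | n b m. b \<and> even m \<and> jump (n, b, m) = ?x0}"
  \<comment> \<open>If \<open>J\<close> is empty, \<open>i1\<close> is a mere placeholder; the extra
    \<open>s ^ 3 / 3\<close> then only weakens the upper bound.\<close>
  define i1 where "i1 = (if J = {} then i0 else (SOME i. i \<in> J))"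
  have jump_eq: "real (Suc m) = 2 * c ^ n" if "jump (n, True, m) = ?x0" for n m
    using that c \<kappa>_pos \<epsilon>_squared(3) by (simp add: jump_def factor_jump_def field_simps del: of_nat_Suc)
  have J_unique: "i = i1" if iJ: "i \<in> J" for i
  proof -
    have "i1 \<in> J" using that someI[of "\<lambda>i. i \<in> J"] by (auto simp: i1_def)
    then obtain n1 m1 where i1: "i1 = (n1, True, m1)" "even m1" "jump (n1, True, m1) = ?x0"
      by (auto simp: J_def)
    obtain n m where i: "i = (n, True, m)" "even m" "jump (n, True, m) = ?x0"
      using iJ by (auto simp: J_def)
    have "n = n1"
      using odd_power_relation_unique[OF c _ jump_eq[OF i(3)] _ jump_eq[OF i1(3)]] i i1 by simp
    then show ?thesis using jump_eq[OF i(3)] jump_eq[OF i1(3)] i i1 by simp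
  qed
  have i0: "jump i0 = ?x0" "weight i0 = - (s\<^sup>2 / 2)"
    by (simp_all add: i0_def jump_def factor_jump_def weight_def factor_weight_def log_weight_def power2_eq_square)
  have i0_J: "i0 \<notin> J" by (auto simp: i0_def J_def)
  define B where "B i = - (s\<^sup>2 / 2) * indicator {i0} i + s ^ 3 / 3 * indicator {i1} i +
      (case i of (n, b, m) \<Rightarrow> if b then 0 else q ^ Suc m / c ^ n) / (2 * \<kappa>)" for i
  have le: "weight i * indicator {i. jump i = ?x0} i \<le> B i" for i
  proof -
    obtain n b m where i: "i = (n, b, m)" by (cases i) auto
    have x0: "\<bar>?x0\<bar> = 2 * \<kappa>" "?x0 \<noteq> 0"
      using \<kappa>_pos \<epsilon>_squared by (auto simp: abs_mult)
    show ?thesis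
    proof (cases "i = i0")
      case True
      then show ?thesis using s_pos i0 by (auto simp: B_def i0_def indicator_def)
    next
      case ne: False
      have Bn: "B i = s ^ 3 / 3 * indicator {i1} i + (if b then 0 else q ^ Suc m / c ^ n) / (2 * \<kappa>)"
        using ne by (simp add: B_def i)
      have B_nonneg: "0 \<le> B i" unfolding Bn using s_pos q c \<kappa>_pos by auto
      show ?thesis
      proof (cases "jump i = ?x0")
        case False
        then show ?thesis using B_nonneg by simp
      next
        case jump: True
        show ?thesis
        proof (cases b)
          case False
          have "weight i = q ^ Suc m / Suc m"
            using False by (simp add: i weight_def factor_weight_def log_weight_def power_minus[of q])
          then have "weight i = \<bar>weight i * jump i\<bar> / (2 * \<kappa>)"
            using x0 q \<kappa>_pos jump by (simp add: abs_mult \<epsilon>_squared)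
          then have "weight i = q ^ Suc m / c ^ n / (2 * \<kappa>)"
            unfolding i abs_weight_mult_jump using False by simp
          then show ?thesis using jump False s_pos by (simp add: Bn)
        next
          case b: True
          have Sm: "real (Suc m) = 2 * c ^ n" using jump_eq jump i b by simp
          have w: "weight i = (-1) ^ m * s ^ Suc m / Suc m"
            by (simp add: i b weight_def factor_weight_def log_weight_def)
          show ?thesis
          proof (cases "even m")
            case False
            then show ?thesis using w s_pos B_nonneg jump by (simp add: order_trans[OF _ B_nonneg])
          next
            case True
            then have "i \<in> J" using jump i b by (auto simp: J_def)
            then have "i = i1" by (rule J_unique)
            have "2 * c ^ n \<ge> 2 * 1" using c by (intro mult_left_mono) auto
            then have "m \<ge> 1" using Sm by simp
            then have "m \<ge> 2" using True by (cases "m = 1") auto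
            have "weight i = s ^ Suc m / Suc m" using w True by simp
            also have "\<dots> \<le> s ^ 3 / 3"
              using \<open>m \<ge> 2\<close> s_pos s_less_one by (intro frac_le power_decreasing) auto
            also have "s ^ 3 / 3 = B i" using Bn b \<open>i = i1\<close> by simp
            finally show ?thesis using jump by simp
          qed
        qed
      qed
    qed
  qed
  have single: "has_bochner_integral (count_space UNIV) (indicator {i} :: _ \<Rightarrow> real) 1" for i :: "nat \<times> bool \<times> nat"
    using has_bochner_integral_real_indicator[of "{i}" "count_space UNIV"] by (simp add: measure_count_space)
  have B: "has_bochner_integral (count_space UNIV) B (- (s\<^sup>2 / 2) * 1 + s ^ 3 / 3 * 1 + geometric_mass / (2 * \<kappa>))"
    unfolding B_def[abs_def] geometric_mass_def
    by (intro has_bochner_integral_add has_bochner_integral_mult_right single has_bochner_integral_divide_zero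
        has_bochner_integral_integrable integrable_geometric_mass)
  have "mass ?x0 \<le> (\<integral>i. B i \<partial>count_space UNIV)"
    unfolding mass_def
    by (rule integral_mono[OF integrable_fiber integrable.intros[OF B] le])
       (use \<kappa>_pos \<epsilon>_squared in auto)
  then show ?thesis using has_bochner_integral_integral_eq[OF B] by simp
qed

lemma mem_ID0:
  assumes \<sigma>: "real_distribution \<sigma>" and char: "\<And>z. char \<sigma> z = law_char z"
    and \<kappa>_large: "geometric_mass / (2 * \<kappa>) < s\<^sup>2 / 2 - s ^ 3 / 3"
  shows "\<sigma> \<in> ID0"
proof -
  note char' = char[unfolded law_char_def]
  have "\<not> infinitely_divisible \<sigma>"
  proof
    assume "infinitely_divisible \<sigma>"
    then have "0 \<le> mass (2 * \<epsilon> * \<kappa>)"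
      using char' \<kappa>_pos \<epsilon>_squared by (intro infinitely_divisible_imp_mass_nonneg) auto
    then show False using mass_le \<kappa>_large by simp
  qed
  then show ?thesis
    using quasi_infinitely_divisibleI[OF \<sigma> char'] by (simp add: ID0_def)
qed

end

subsection \<open>Marginals of the driving process\<close>

text \<open>The library's \<open>poisson_pmf\<close> is only specified for positive rates.\<close>

definition poisson_law :: "real \<Rightarrow> nat pmf" where
  "poisson_law a = (if a > 0 then poisson_pmf a else return_pmf 0)"

lemma pmf_poisson_law: "a \<ge> 0 \<Longrightarrow> pmf (poisson_law a) n = a ^ n / fact n * exp (- a)"
  by (auto simp: poisson_law_def pmf_return indicator_def)

lemma integral_poisson_law:
  fixes f :: "nat \<Rightarrow> 'b::{banach, second_countable_topology}"
  shows "(\<integral>n. f n \<partial>poisson_law a) = (\<integral>n. pmf (poisson_law a) n *\<^sub>R f n \<partial>count_space UNIV)"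
  unfolding measure_pmf_eq_density by (simp add: integral_density)

lemma poisson_law_generating_function:
  fixes \<zeta> :: "'b::{real_normed_field, banach, second_countable_topology}"
  assumes "a \<ge> 0"
  shows "(\<integral>n. \<zeta> ^ n \<partial>poisson_law a) = exp (of_real a * (\<zeta> - 1))"
proof -
  let ?f = "\<lambda>n. pmf (poisson_law a) n *\<^sub>R \<zeta> ^ n"
  have eq: "?f n = exp (- a) *\<^sub>R ((a *\<^sub>R \<zeta>) ^ n /\<^sub>R fact n)" for n
    using assms by (simp add: pmf_poisson_law scaleR_conv_of_real power_mult_distrib divide_inverse mult_ac)
  have sums: "?f sums (exp (- a) *\<^sub>R exp (a *\<^sub>R \<zeta>))"
    unfolding eq by (intro sums_scaleR_right exp_converges)
  have "norm (?f n) = exp (- a) *\<^sub>R ((a * norm \<zeta>) ^ n /\<^sub>R fact n)" for n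
    unfolding eq using assms by (simp add: norm_power power_mult_distrib)
  then have "integrable (count_space UNIV) ?f"
    unfolding integrable_count_space_nat_iff
    by (simp only:) (intro summable_scaleR_right sums_summable[OF exp_converges])
  then have "(\<integral>n. ?f n \<partial>count_space UNIV) = exp (- a) *\<^sub>R exp (a *\<^sub>R \<zeta>)"
    using sums sums_unique2 sums_integral_count_space_nat by blast
  then show ?thesis
    by (simp add: integral_poisson_law scaleR_conv_of_real exp_of_real[symmetric] exp_add[symmetric] algebra_simps)
qed

text \<open>By \<open>exp (- a) \<ge> 1 - a\<close>, the values 0 and 1 together have probability at
  least \<open>(1 + a) * (1 - a)\<close>.\<close>

lemma poisson_law_ge_2_le:
  assumes "a \<ge> 0"
  shows "measure (poisson_law a) {2..} \<le> a\<^sup>2"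
proof -
  have "measure (poisson_law a) {2..} = 1 - measure (poisson_law a) {0, 1}"
  proof -
    have "{2..} = space (poisson_law a) - {0, 1::nat}" by auto
    then have "measure (poisson_law a) {2..} = measure (poisson_law a) (space (poisson_law a) - {0, 1})"
      by (rule arg_cong)
    also have "\<dots> = 1 - measure (poisson_law a) {0, 1}"
      by (rule measure_pmf.prob_compl) simp
    finally show ?thesis .
  qed
  also have "measure (poisson_law a) {0, 1} = (1 + a) * exp (- a)"
    using assms by (subst measure_measure_pmf_finite) (auto simp: pmf_poisson_law algebra_simps)
  also have "(1 + a) * exp (- a) \<ge> (1 + a) * (1 - a)"
    using assms exp_ge_add_one_self[of "- a"] by (intro mult_left_mono) auto
  then have "1 - (1 + a) * exp (- a) \<le> a\<^sup>2"
    by (simp add: algebra_simps power2_eq_square)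
  finally show ?thesis .
qed

lemma char_poisson_law:
  assumes "a \<ge> 0"
  shows "(CLINT n|measure_pmf (poisson_law a). iexp (z * (b * real n))) = exp (of_real a * (iexp (z * b) - 1))"
proof -
  have "iexp (z * (b * real n)) = iexp (z * b) ^ n" for n
    unfolding exp_of_nat_mult[symmetric] by (simp add: algebra_simps)
  then show ?thesis using poisson_law_generating_function[OF assms, of "iexp (z * b)"] by simp
qed

lemma (in prob_space) distr_eqI_char:
  assumes "prob_space P" and X: "random_variable borel X" and Y: "Y \<in> borel_measurable P"
    and char: "\<And>z. (CLINT \<omega>|M. iexp (z * X \<omega>)) = (CLINT \<omega>|P. iexp (z * Y \<omega>))"
  shows "distr M borel X = distr P borel (Y :: _ \<Rightarrow> real)"
proof (rule Levy_uniqueness)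
  interpret P: prob_space P by fact
  show "real_distribution (distr M borel X)" "real_distribution (distr P borel Y)"
    using X Y by simp_all
  show "char (distr M borel X) = char (distr P borel Y)"
    unfolding char_def fun_eq_iff using X Y char by (simp add: integral_distr)
qed

text \<open>The process is known only through its characteristic function. Almost sure properties
  such as integer values are therefore proved on an explicit space with the same law and carried
  back.\<close>

lemma AE_distr_eq_transfer:
  assumes eq: "distr M borel X = distr P borel Y" and m: "X \<in> borel_measurable M" "Y \<in> borel_measurable P"
    and S: "S \<in> sets borel" and AE: "AE \<omega> in P. Y \<omega> \<in> S"
  shows "AE \<omega> in M. X \<omega> \<in> S"
proof -
  have "AE y in distr P borel Y. y \<in> S" using AE S m by (simp add: AE_distr_iff)
  then have "AE y in distr M borel X. y \<in> S" unfolding eq .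
  then show ?thesis using S m by (simp add: AE_distr_iff)
qed

lemma integral_jump_measure:
  fixes f :: "real \<times> real \<Rightarrow> 'b::{banach, second_countable_topology}"
  assumes c: "c > 0" and uvw: "u \<ge> 0" "v \<ge> 0" "w \<ge> 0" and f[measurable]: "f \<in> borel_measurable borel"
  shows "(\<integral>x. f x \<partial>jump_measure c k u v w) = u *\<^sub>R f (1, 0) + v *\<^sub>R f (0, 1) + w *\<^sub>R f (1, c powi (- k))"
proof -
  let ?J = "jump_measure c k u v w"
  define \<kappa> where "\<kappa> = c powi (- k)"
  \<comment> \<open>Keeps the atoms \<open>(1, 0)\<close> and \<open>(1, \<kappa>)\<close>
    apart.\<close>
  have \<kappa>: "\<kappa> \<noteq> 0" using c by (simp add: \<kappa>_def)
  note em = emeasure_jump_measure[OF uvw, of _ c k, folded \<kappa>_def]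
  have m: "measure ?J {(1, 0)} = u" "measure ?J {(0, 1)} = v" "measure ?J {(1, \<kappa>)} = w"
    using \<kappa> uvw by (auto simp: measure_def em)
  have hb: "has_bochner_integral ?J (\<lambda>y. indicator {x} y *\<^sub>R f x) (measure ?J {x} *\<^sub>R f x)" for x
    using uvw by (intro has_bochner_integral_indicator) (auto simp: em)
  have "has_bochner_integral ?J (\<lambda>y. indicator {(1, 0)} y *\<^sub>R f (1, 0) + indicator {(0, 1)} y *\<^sub>R f (0, 1) +
      indicator {(1, \<kappa>)} y *\<^sub>R f (1, \<kappa>)) (u *\<^sub>R f (1, 0) + v *\<^sub>R f (0, 1) + w *\<^sub>R f (1, \<kappa>))"
    using hb[of "(1, 0)"] hb[of "(0, 1)"] hb[of "(1, \<kappa>)"] unfolding m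
    by (intro has_bochner_integral_add)
  moreover have "AE y in ?J. f y = indicator {(1, 0)} y *\<^sub>R f (1, 0) + indicator {(0, 1)} y *\<^sub>R f (0, 1) +
      indicator {(1, \<kappa>)} y *\<^sub>R f (1, \<kappa>)"
  proof (rule AE_I')
    show "- {(1, 0), (0, 1), (1, \<kappa>)} \<in> null_sets ?J"
      by (auto simp: null_sets_def em)
    show "{y \<in> space ?J. f y \<noteq> indicator {(1, 0)} y *\<^sub>R f (1, 0) + indicator {(0, 1)} y *\<^sub>R f (0, 1) +
      indicator {(1, \<kappa>)} y *\<^sub>R f (1, \<kappa>)} \<subseteq> - {(1, 0), (0, 1), (1, \<kappa>)}"
      using \<kappa> by auto
  qed
  ultimately have "has_bochner_integral ?J f (u *\<^sub>R f (1, 0) + v *\<^sub>R f (0, 1) + w *\<^sub>R f (1, \<kappa>))"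
    by (subst has_bochner_integral_cong_AE) auto
  then show ?thesis
    by (simp add: has_bochner_integral_integral_eq \<kappa>_def)
qed

section \<open>The bivariate process at fixed times\<close>

locale poisson_pair =
  fixes c u v w :: real and k :: int and M :: "'a measure" and Z :: "real \<Rightarrow> 'a \<Rightarrow> real \<times> real"
  assumes c: "c > 1" and u: "u \<ge> 0" and v: "v \<ge> 0" and w: "w \<ge> 0"
    and cpp: "compound_poisson_process M Z (jump_measure c k u v w)"
begin

definition \<kappa> :: real where "\<kappa> = c powi (- k)"

text \<open>The exponent of the pair at time 1, with y the frequency of N and z the frequency of
  L.\<close>

definition kernel :: "real \<Rightarrow> real \<Rightarrow> complex" where
  "kernel y z = u * (iexp y - 1) + v * (iexp z - 1) + w * (iexp (y + z * \<kappa>) - 1)"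

lemma levy: "levy_process M Z"
  using cpp by (simp add: compound_poisson_process_def)

sublocale prob_space M
  using levy by (simp add: levy_process_def)

lemma measurable_Z: "t \<ge> 0 \<Longrightarrow> Z t \<in> borel_measurable M"
  using levy by (simp add: levy_process_def)

lemma \<kappa>_pos: "\<kappa> > 0"
  using c by (simp add: \<kappa>_def)

lemma joint_char:
  assumes "t \<ge> 0"
  shows "(CLINT \<omega>|M. iexp (y * fst (Z t \<omega>) + z * snd (Z t \<omega>))) = exp (t * kernel y z)"
proof -
  have "(CLINT \<omega>|M. iexp ((y, z) \<bullet> Z t \<omega>)) =
      exp (t * (CLINT x|jump_measure c k u v w. iexp ((y, z) \<bullet> x) - 1))"
    using cpp assms unfolding compound_poisson_process_def by blast
  also have "(CLINT x|jump_measure c k u v w. iexp ((y, z) \<bullet> x) - 1) = kernel y z"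
    by (subst integral_jump_measure)
       (use c u v w in \<open>auto simp: kernel_def \<kappa>_def scaleR_conv_of_real\<close>)
  finally show ?thesis by (simp add: inner_prod_def)
qed

lemma measurable_fst_Z: "t \<ge> 0 \<Longrightarrow> (\<lambda>\<omega>. fst (Z t \<omega>)) \<in> borel_measurable M"
  and measurable_snd_Z: "t \<ge> 0 \<Longrightarrow> (\<lambda>\<omega>. snd (Z t \<omega>)) \<in> borel_measurable M"
  using measurable_Z[of t] by (auto simp: borel_prod[symmetric])

lemma distr_fst_Z:
  assumes t: "t \<ge> 0"
  shows "distr M borel (\<lambda>\<omega>. fst (Z t \<omega>)) = distr (measure_pmf (poisson_law ((u + w) * t))) borel real"
proof (rule distr_eqI_char)
  fix z
  have "(CLINT \<omega>|M. iexp (z * fst (Z t \<omega>))) = exp (t * kernel z 0)"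
    using joint_char[OF t, of z 0] by simp
  also have "\<dots> = (CLINT n|measure_pmf (poisson_law ((u + w) * t)). iexp (z * (1 * real n)))"
    using u w t by (subst char_poisson_law) (auto simp: kernel_def algebra_simps)
  finally show "(CLINT \<omega>|M. iexp (z * fst (Z t \<omega>))) =
      (CLINT n|measure_pmf (poisson_law ((u + w) * t)). iexp (z * real n))" by simp
qed (use t measurable_fst_Z prob_space_measure_pmf in auto)

lemma AE_fst_Z_Nats: "t \<ge> 0 \<Longrightarrow> AE \<omega> in M. fst (Z t \<omega>) \<in> \<nat>"
  by (rule AE_distr_eq_transfer[OF distr_fst_Z])
     (auto simp: measurable_fst_Z Nats_def intro: sets.countable)

lemma prob_fst_Z_ge_2_le:
  assumes t: "t \<ge> 0"
  shows "prob {\<omega> \<in> space M. fst (Z t \<omega>) \<ge> 2} \<le> ((u + w) * t)\<^sup>2"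
proof -
  note [measurable] = measurable_fst_Z[OF t]
  have "prob {\<omega> \<in> space M. fst (Z t \<omega>) \<ge> 2} = measure (distr M borel (\<lambda>\<omega>. fst (Z t \<omega>))) {2..}"
    by (subst measure_distr) (auto intro!: arg_cong[where f = prob])
  also have "\<dots> = measure (poisson_law ((u + w) * t)) {2..}"
    unfolding distr_fst_Z[OF t] by (subst measure_distr) (auto intro!: arg_cong2[where f = measure])
  also have "\<dots> \<le> ((u + w) * t)\<^sup>2"
    using u w t by (intro poisson_law_ge_2_le) simp
  finally show ?thesis .
qed

text \<open>The Poisson generating function at \<open>1 / c\<close>. If \<open>u + w > 0\<close>, it
  decays exponentially in t, a quantitative substitute for the divergence of N.\<close>

lemma expectation_powr_fst_Z:
  assumes t: "t \<ge> 0"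
  shows "expectation (\<lambda>\<omega>. c powr (- fst (Z t \<omega>))) = exp ((u + w) * t * (1 / c - 1))"
proof -
  note [measurable] = measurable_fst_Z[OF t]
  have powr: "c powr (- real n) = (1 / c) ^ n" for n
    using c by (simp add: powr_minus powr_realpow power_inverse divide_inverse)
  have "expectation (\<lambda>\<omega>. c powr (- fst (Z t \<omega>))) =
      (\<integral>x. c powr (- x) \<partial>distr M borel (\<lambda>\<omega>. fst (Z t \<omega>)))"
    by (subst integral_distr) auto
  also have "\<dots> = (\<integral>n. (1 / c) ^ n \<partial>poisson_law ((u + w) * t))"
    unfolding distr_fst_Z[OF t] by (subst integral_distr) (auto simp: powr)
  also have "\<dots> = exp ((u + w) * t * (1 / c - 1))"
    using u w t by (subst poisson_law_generating_function) auto
  finally show ?thesis .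
qed

text \<open>The characteristic function factorises into that of \<open>n + \<kappa> * m\<close> with
  independent Poisson variables n and m, whose values are nonnegative.\<close>

lemma AE_snd_Z_nonneg:
  assumes t: "t \<ge> 0"
  shows "AE \<omega> in M. snd (Z t \<omega>) \<in> {0..}"
proof -
  define A where "A = measure_pmf (poisson_law (v * t))"
  define B where "B = measure_pmf (poisson_law (w * t))"
  interpret A: prob_space A unfolding A_def by (rule prob_space_measure_pmf)
  interpret B: prob_space B unfolding B_def by (rule prob_space_measure_pmf)
  interpret AB: pair_prob_space A B ..
  let ?Y = "\<lambda>(n, m). real n + \<kappa> * real m"
  have sets: "sets A = UNIV" "sets B = UNIV" by (auto simp: A_def B_def)
  have [measurable]: "real \<in> borel_measurable A" "real \<in> borel_measurable B"
      "complex_of_nat \<in> borel_measurable A" "complex_of_nat \<in> borel_measurable B"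
    by (auto simp: A_def B_def)
  have Y[measurable]: "?Y \<in> borel_measurable (A \<Otimes>\<^sub>M B)"
    by measurable
  have "distr M borel (\<lambda>\<omega>. snd (Z t \<omega>)) = distr (A \<Otimes>\<^sub>M B) borel ?Y"
  proof (rule distr_eqI_char)
    fix z
    have "(CLINT \<omega>|M. iexp (z * snd (Z t \<omega>))) = exp (t * kernel 0 z)"
      using joint_char[OF t, of 0 z] by simp
    also have "\<dots> = exp (of_real (v * t) * (iexp (z * 1) - 1)) * exp (of_real (w * t) * (iexp (z * \<kappa>) - 1))"
      by (simp add: exp_add[symmetric] kernel_def algebra_simps)
    also have "\<dots> = (CLINT n|A. iexp (z * (1 * real n))) * (CLINT m|B. iexp (z * (\<kappa> * real m)))"
      unfolding A_def B_def using v w t by (subst (1 2) char_poisson_law) auto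
    also have "\<dots> = (CLINT n|A. CLINT m|B. iexp (z * (1 * real n)) * iexp (z * (\<kappa> * real m)))"
      by simp
    also have "\<dots> = (CLINT x|A \<Otimes>\<^sub>M B. (case x of (n, m) \<Rightarrow> iexp (z * (1 * real n)) * iexp (z * (\<kappa> * real m))))"
      by (rule AB.integral_fst, rule AB.integrable_const_bound[where B = 1])
         (auto simp: norm_mult)
    also have "\<dots> = (CLINT x|A \<Otimes>\<^sub>M B. iexp (z * ?Y x))"
      by (rule Bochner_Integration.integral_cong)
         (auto simp: exp_add[symmetric] algebra_simps)
    finally show "(CLINT \<omega>|M. iexp (z * snd (Z t \<omega>))) = (CLINT x|A \<Otimes>\<^sub>M B. iexp (z * ?Y x))" .
  qed (use Y t measurable_snd_Z AB.prob_space_axioms in auto)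
  then show ?thesis
    by (rule AE_distr_eq_transfer) (use t measurable_snd_Z Y \<kappa>_pos in auto)
qed

lemma increment_distr:
  assumes "0 \<le> s" "0 \<le> h"
  shows "distr M borel (\<lambda>\<omega>. Z (s + h) \<omega> - Z s \<omega>) = distr M borel (Z h)"
  using levy assms by (simp add: levy_process_def)

lemma measurable_increment:
  assumes "0 \<le> s" "0 \<le> h"
  shows "(\<lambda>\<omega>. Z (s + h) \<omega> - Z s \<omega>) \<in> borel_measurable M"
  using measurable_Z assms by simp

lemma AE_Z_zero: "AE \<omega> in M. Z 0 \<omega> = 0"
  using levy by (simp add: levy_process_def)

lemma AE_increment_snd_nonneg:
  assumes "0 \<le> s" "s \<le> t"
  shows "AE \<omega> in M. snd (Z s \<omega>) \<le> snd (Z t \<omega>)"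
proof -
  have "AE \<omega> in M. Z (s + (t - s)) \<omega> - Z s \<omega> \<in> {x. snd x \<ge> 0}"
    by (rule AE_distr_eq_transfer[OF increment_distr])
       (use assms AE_snd_Z_nonneg[of "t - s"] measurable_increment[of s "t - s"] in
         \<open>auto intro!: borel_closed closed_Collect_le continuous_intros measurable_Z\<close>)
  then show ?thesis by simp
qed

lemma AE_increment_fst_Nats:
  assumes "0 \<le> s" "s \<le> t"
  shows "AE \<omega> in M. fst (Z t \<omega>) - fst (Z s \<omega>) \<in> \<nat>"
proof -
  have "fst -` \<nat> \<inter> space borel \<in> sets (borel :: (real \<times> real) measure)"
    by (rule measurable_sets[where A = borel])
       (auto simp: Nats_def borel_prod[symmetric] intro: sets.countable)
  then have "AE \<omega> in M. Z (s + (t - s)) \<omega> - Z s \<omega> \<in> fst -` \<nat>"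
    by (intro AE_distr_eq_transfer[OF increment_distr])
       (use assms AE_fst_Z_Nats[of "t - s"] measurable_increment[of s "t - s"] in
        \<open>auto intro!: measurable_Z\<close>)
  then show ?thesis by simp
qed

lemma AE_fst_Z_nonneg:
  assumes "t \<ge> 0"
  shows "AE \<omega> in M. 0 \<le> fst (Z t \<omega>)"
  using AE_fst_Z_Nats[OF assms] by eventually_elim (auto simp: Nats_def)

end

subsection \<open>Riemann sums and one-step estimates\<close>

text \<open>
  \<open>\<lceil>s / h\<rceil> - 1\<close> is the index of the cell \<open>(ih, (i + 1)h]\<close> that contains \<open>s\<close>; its left end point
  increases strictly to the left limit point \<open>s\<close> when the mesh \<open>h\<close> tends to 0.
\<close>

lemma grid_left_endpoint_filterlim:
  fixes s t :: real
  assumes "t > 0"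
  shows "filterlim (\<lambda>n. (\<lceil>s / (t / real (Suc n))\<rceil> - 1) * (t / real (Suc n))) (at_left s) sequentially"
proof -
  let ?h = "\<lambda>n. t / real (Suc n)"
  let ?g = "\<lambda>n. (\<lceil>s / ?h n\<rceil> - 1) * ?h n"
  have h: "?h n > 0" for n using assms by simp
  have less: "?g n < s" for n
  proof -
    have "of_int (\<lceil>s / ?h n\<rceil> - 1) < s / ?h n" by linarith
    then show ?thesis using iffD1[OF pos_less_divide_eq[OF h[of n]]] by blast
  qed
  have ge: "s - ?h n \<le> ?g n" for n
  proof -
    have "s / ?h n - 1 \<le> of_int \<lceil>s / ?h n\<rceil> - 1" by linarith
    then have "(s / ?h n - 1) * ?h n \<le> ?g n" using h[of n] by (intro mult_right_mono) auto
    moreover have "(s / x - 1) * x = s - x" if "x > 0" for x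
      using that by (simp add: left_diff_distrib)
    ultimately show ?thesis using h[of n] by metis
  qed
  have lim: "(\<lambda>n. s - ?h n) \<longlonglongrightarrow> s"
  proof -
    have "(\<lambda>n. s - t * inverse (real (Suc n))) \<longlonglongrightarrow> s - t * 0"
      by (intro tendsto_diff tendsto_mult tendsto_const LIMSEQ_inverse_real_of_nat)
    then show ?thesis by (simp add: divide_inverse)
  qed
  have "?g n \<in> {..<s} \<and> ?g n \<noteq> s" for n
    using less[of n] by (metis lessThan_iff less_irrefl)
  moreover have "?g \<longlonglongrightarrow> s"
    by (rule tendsto_sandwich[OF _ _ lim tendsto_const])
       (intro always_eventually allI ge less_imp_le[OF less])+
  ultimately show ?thesis
    unfolding filterlim_at by (simp only: always_eventually simp_thms)
qed

text \<open>The sums are integrals of step functions \<phi> that freeze the integrand at the left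
  end point of each cell. These end points approach s strictly from the left, which yields the left
  limit, and \<open>f \<ge> 0\<close> on the grid bounds \<phi> by 1 for dominated
  convergence.\<close>

lemma Riemann_sums_tendsto_Stieltjes:
  fixes F f :: "real \<Rightarrow> real"
  assumes c: "c > 1" and t: "t > 0"
    and mono: "\<And>x y. 0 \<le> x \<Longrightarrow> x \<le> y \<Longrightarrow> F x \<le> F y"
    and rcont: "\<And>x. 0 \<le> x \<Longrightarrow> continuous (at_right x) F"
    and left: "\<And>s. 0 < s \<Longrightarrow> \<exists>l. (f \<longlongrightarrow> l) (at_left s)"
    and nonneg: "\<And>n i. f (real i * (t / real (Suc n))) \<ge> 0"
  shows "(\<lambda>n. \<Sum>i<Suc n. c powr (- f (real i * (t / real (Suc n)))) *
            (F (real (Suc i) * (t / real (Suc n))) - F (real i * (t / real (Suc n)))))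
     \<longlonglongrightarrow> (LINT s:{0<..t}|interval_measure (\<lambda>s. F (max 0 s)). c powr (- Lim (at_left s) f))"
proof -
  let ?h = "\<lambda>n. t / real (Suc n)"
  define m where "m = interval_measure (\<lambda>s. F (max 0 s))"
  have h: "?h n > 0" for n using t by simp
  have sets_m [measurable_cong, simp]: "sets m = sets borel" by (simp add: m_def)
  have monoF: "F (max 0 x) \<le> F (max 0 y)" if "x \<le> y" for x y
    using that by (intro mono) auto
  have contF: "continuous (at_right a) (\<lambda>s. F (max 0 s))" for a
  proof (cases "a \<ge> 0")
    case True
    have "(F \<longlongrightarrow> F a) (at_right a)" using rcont[OF True] by (simp add: continuous_within)
    moreover have "eventually (\<lambda>s. F s = F (max 0 s)) (at_right a)"
      using True by (auto simp: eventually_at_filter intro!: always_eventually)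
    ultimately show ?thesis using True by (simp add: continuous_within Lim_transform_eventually)
  next
    case False
    have "eventually (\<lambda>s. s < 0) (at_right a)"
      using False by (intro eventually_at_rightI[of a 0]) auto
    then have "eventually (\<lambda>s. F 0 = F (max 0 s)) (at_right a)"
      by eventually_elim (simp add: max_def)
    then show ?thesis using False
      by (simp add: continuous_within max_def Lim_transform_eventually[OF tendsto_const])
  qed
  have em: "emeasure m {a<..b} = F (max 0 b) - F (max 0 a)" if "a \<le> b" for a b
    unfolding m_def using that monoF contF by (rule emeasure_interval_measure_Ioc)
  have me: "measure m {a<..b} = F (max 0 b) - F (max 0 a)" if "a \<le> b" for a b
    using em[OF that] monoF[OF that] by (simp add: measure_def)
  define \<phi> where "\<phi> n s = (\<Sum>i<Suc n. c powr (- f (real i * ?h n)) * indicator {real i * ?h n<..real (Suc i) * ?h n} s)" for n s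
  have \<phi>_measurable [measurable]: "\<phi> n \<in> borel_measurable borel" for n
    unfolding \<phi>_def by measurable
  have \<phi>_int: "(\<integral>s. \<phi> n s \<partial>m) = (\<Sum>i<Suc n. c powr (- f (real i * ?h n)) * (F (real (Suc i) * ?h n) - F (real i * ?h n)))" for n
  proof -
    have cell: "has_bochner_integral m (indicator {real i * ?h n<..real (Suc i) * ?h n})
        (F (real (Suc i) * ?h n) - F (real i * ?h n))" for i
    proof -
      have "real i * ?h n \<le> real (Suc i) * ?h n" using h[of n] by (intro mult_right_mono) auto
      moreover have "0 \<le> real i * ?h n" "0 \<le> real (Suc i) * ?h n" using t by auto
      ultimately show ?thesis
        using has_bochner_integral_real_indicator[of "{real i * ?h n<..real (Suc i) * ?h n}" m]
        by (simp add: em me max_absorb2 del: of_nat_Suc)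
    qed
    show ?thesis unfolding \<phi>_def
      by (intro has_bochner_integral_integral_eq has_bochner_integral_sum has_bochner_integral_mult_right cell)
  qed
  define \<psi> where "\<psi> s = indicator {0<..t} s * c powr (- Lim (at_left s) f)" for s
  have \<phi>_eq: "\<phi> n s = c powr (- f ((\<lceil>s / ?h n\<rceil> - 1) * ?h n))" and \<phi>_idx: "\<exists>i. \<phi> n s = c powr (- f (real i * ?h n))"
    if s: "0 < s" "s \<le> t" for n s
  proof -
    define i where "i = nat (\<lceil>s / ?h n\<rceil> - 1)"
    have pos: "s / ?h n > 0" using s h[of n] by (intro divide_pos_pos) auto
    have "s / ?h n \<le> t / ?h n" using s h[of n] by (intro divide_right_mono) auto
    also have "\<dots> = real (Suc n)" using t by simp
    finally have le: "s / ?h n \<le> real (Suc n)" .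
    have i: "real i = of_int \<lceil>s / ?h n\<rceil> - 1" using pos unfolding i_def by linarith
    have "i < Suc n" using le pos unfolding i_def by linarith
    have mem: "s \<in> {real j * ?h n<..real (Suc j) * ?h n} \<longleftrightarrow> j = i" for j
    proof -
      have "s \<in> {real j * ?h n<..real (Suc j) * ?h n} \<longleftrightarrow> real j < s / ?h n \<and> s / ?h n \<le> real (Suc j)"
        by (simp only: pos_less_divide_eq[OF h] pos_divide_le_eq[OF h] greaterThanAtMost_iff)
      also have "\<dots> \<longleftrightarrow> \<lceil>s / ?h n\<rceil> = int (Suc j)"
        by (auto simp: ceiling_eq_iff)
      also have "\<dots> \<longleftrightarrow> j = i" using i by linarith
      finally show ?thesis .
    qed
    have "\<phi> n s = (\<Sum>j<Suc n. if j = i then c powr (- f (real j * ?h n)) else 0)"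
      unfolding \<phi>_def by (intro sum.cong refl) (simp only: indicator_def mem, simp)
    also have "\<dots> = c powr (- f (real i * ?h n))"
      using \<open>i < Suc n\<close> by (simp add: sum.delta' del: sum.lessThan_Suc)
    finally have *: "\<phi> n s = c powr (- f (real i * ?h n))" .
    then show "\<exists>i. \<phi> n s = c powr (- f (real i * ?h n))" by blast
    show "\<phi> n s = c powr (- f ((\<lceil>s / ?h n\<rceil> - 1) * ?h n))" using * by (simp add: i)
  qed
  have \<phi>_0: "\<phi> n s = 0" if "\<not> (0 < s \<and> s \<le> t)" for n s
  proof -
    have "s \<notin> {real i * ?h n<..real (Suc i) * ?h n}" if "i < Suc n" for i
    proof
      assume s: "s \<in> {real i * ?h n<..real (Suc i) * ?h n}"
      have "0 \<le> real i * ?h n" using t by simp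
      then have "0 < s" using s by simp
      have "real (Suc i) * ?h n \<le> real (Suc n) * ?h n"
        using that h[of n] by (intro mult_right_mono) auto
      also have "\<dots> = t" by simp
      finally have "s \<le> t" using s by simp
      then show False using \<open>0 < s\<close> \<open>\<not> (0 < s \<and> s \<le> t)\<close> by simp
    qed
    then show ?thesis unfolding \<phi>_def by (intro sum.neutral) auto
  qed
  have lim: "(\<lambda>n. \<phi> n s) \<longlonglongrightarrow> \<psi> s" for s
  proof (cases "0 < s \<and> s \<le> t")
    case True
    then obtain l where l: "(f \<longlongrightarrow> l) (at_left s)" using left by blast
    then have "Lim (at_left s) f = l" by (intro tendsto_Lim) auto
    moreover have "(\<lambda>n. f ((\<lceil>s / ?h n\<rceil> - 1) * ?h n)) \<longlonglongrightarrow> l"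
      by (rule filterlim_compose[OF l grid_left_endpoint_filterlim[OF t]])
    then have "(\<lambda>n. c powr (- f ((\<lceil>s / ?h n\<rceil> - 1) * ?h n))) \<longlonglongrightarrow> c powr (- l)"
      using c by (intro tendsto_intros) auto
    ultimately show ?thesis using True \<phi>_eq by (simp add: \<psi>_def)
  next
    case False
    then show ?thesis by (simp add: \<phi>_0 \<psi>_def)
  qed
  \<comment> \<open>Of \<open>f\<close> only left limits at positive times and nonnegativity on the
    grid are known, so measurability is inherited from the step functions.\<close>
  have "\<psi> \<in> borel_measurable m"
    by (rule borel_measurable_LIMSEQ_real[where u = \<phi>]) (auto intro: lim)
  then have "(\<lambda>n. \<integral>s. \<phi> n s \<partial>m) \<longlonglongrightarrow> (\<integral>s. \<psi> s \<partial>m)"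
  proof (rule integral_dominated_convergence[where w = "indicator {0<..t}"])
    show "integrable m (indicator {0<..t} :: real \<Rightarrow> real)"
      using t em[of 0 t] by (simp add: integrable_real_indicator)
    show "AE s in m. norm (\<phi> n s) \<le> indicator {0<..t} s" for n
    proof (rule AE_I2)
      fix s
      show "norm (\<phi> n s) \<le> indicator {0<..t} s"
      proof (cases "0 < s \<and> s \<le> t")
        case True
        then obtain i where i: "\<phi> n s = c powr (- f (real i * ?h n))" using \<phi>_idx by blast
        have "c powr (- f (real i * ?h n)) \<le> c powr 0"
          using c nonneg[of i n] by (intro powr_mono) auto
        then show ?thesis using True i c by simp
      qed (simp add: \<phi>_0)
    qed
  qed (auto intro: lim)
  then show ?thesis
    unfolding \<phi>_int m_def[symmetric] \<psi>_def set_lebesgue_integral_def by simp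
qed

lemma norm_exp_minus_linear_le: "norm (exp z - 1 - z) \<le> exp (norm z) * (norm z)\<^sup>2" for z :: complex
  using Taylor_exp_field[of z 1] by (simp add: atMost_Suc power2_eq_square diff_diff_eq add.commute)

section \<open>A single time step\<close>

context poisson_pair
begin

definition rate :: real where "rate = u + v + w"

lemma rate_nonneg: "rate \<ge> 0"
  using u v w by (simp add: rate_def)

text \<open>The transition operator of one time step: the frequency z is rescaled by
  \<open>c powr (- N)\<close> and the increment of L contributes a phase. The functional equation
  says that \<open>g\<close> is fixed to first order in h.\<close>

definition step :: "(real \<Rightarrow> complex) \<Rightarrow> real \<Rightarrow> real \<Rightarrow> complex" where
  "step g h z = (CLINT \<omega>|M. iexp (z * snd (Z h \<omega>)) * g (c powr (- fst (Z h \<omega>)) * z))"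

text \<open>Each difference \<open>iexp a - 1\<close> has norm at most 2, so \<open>2 * rate\<close>
  bounds the kernel; with \<open>h \<le> 1\<close> the constant is uniform in y and z.\<close>

lemma exp_kernel_approx:
  assumes h: "0 \<le> h" "h \<le> 1"
  shows "norm (exp (h * kernel y z) - 1 - h * kernel y z) \<le> exp (2 * rate) * (2 * rate)\<^sup>2 * h\<^sup>2"
proof -
  have two: "norm (iexp a - 1) \<le> 2" for a using norm_triangle_ineq4[of "iexp a" 1] by simp
  have "norm (kernel y z) \<le> norm (u * (iexp y - 1)) + norm (v * (iexp z - 1)) + norm (w * (iexp (y + z * \<kappa>) - 1))"
    unfolding kernel_def by (intro order_trans[OF norm_triangle_ineq] add_mono order_refl norm_triangle_ineq)
  also have "\<dots> \<le> u * 2 + v * 2 + w * 2"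
    unfolding norm_mult norm_of_real using u v w two[of y] two[of z] two[of "y + z * \<kappa>"]
    by (intro add_mono mult_mono) simp_all
  finally have "norm (kernel y z) \<le> 2 * rate" by (simp add: rate_def)
  then have le: "norm (h * kernel y z) \<le> h * (2 * rate)"
    using h by (simp add: norm_mult mult_left_mono)
  have "norm (exp (h * kernel y z) - 1 - h * kernel y z) \<le> exp (norm (h * kernel y z)) * (norm (h * kernel y z))\<^sup>2"
    by (rule norm_exp_minus_linear_le)
  also have "\<dots> \<le> exp (2 * rate) * (h * (2 * rate))\<^sup>2"
    using le h rate_nonneg mult_right_mono[of h 1 "2 * rate"] by (intro mult_mono power_mono) auto
  finally show ?thesis by (simp add: power_mult_distrib mult_ac)
qed

text \<open>
  Since \<open>N\<^sub>h\<close> is integer-valued and \<open>N\<^sub>h \<ge> 2\<close> has probability \<open>O(h\<^sup>2)\<close>, the two parts of the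
  characteristic function of \<open>L\<^sub>h\<close> on \<open>N\<^sub>h = 0\<close> and on \<open>N\<^sub>h = 1\<close> can be read off from the joint
  characteristic function at the frequencies \<open>0\<close> and \<open>\<pi>\<close> of \<open>N\<^sub>h\<close>.
\<close>

lemma step_approx:
  fixes g :: "real \<Rightarrow> complex"
  assumes g [measurable]: "g \<in> borel_measurable borel"
    and bound: "\<And>z. \<bar>z\<bar> \<le> R \<Longrightarrow> norm (g z) \<le> B"
    and eq: "\<And>z. \<bar>z\<bar> \<le> R \<Longrightarrow> rate * g z = u * g (z / c) + v * iexp z * g z + w * iexp (\<kappa> * z) * g (z / c)"
    and h: "0 \<le> h" "h \<le> 1" and z: "\<bar>z\<bar> \<le> R"
  shows "norm (step g h z - g z) \<le> B * (3 * rate\<^sup>2 + 2 * (exp (2 * rate) * (2 * rate)\<^sup>2)) * h\<^sup>2"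
proof -
  let ?N = "\<lambda>\<omega>. fst (Z h \<omega>)" and ?L = "\<lambda>\<omega>. snd (Z h \<omega>)"
  note [measurable] = measurable_fst_Z[OF h(1)] measurable_snd_Z[OF h(1)]
  have B: "B \<ge> 0" using bound[OF z] norm_ge_zero order_trans by blast
  define T where "T = {\<omega> \<in> space M. ?N \<omega> \<ge> 2}"
  have [measurable]: "T \<in> sets M" unfolding T_def by measurable
  have PT: "prob T \<le> rate\<^sup>2 * h\<^sup>2"
  proof -
    have "prob T \<le> ((u + w) * h)\<^sup>2" unfolding T_def by (rule prob_fst_Z_ge_2_le[OF h(1)])
    also have "\<dots> \<le> (rate * h)\<^sup>2"
      using u v w h by (intro power_mono mult_right_mono) (auto simp: rate_def)
    finally show ?thesis by (simp add: power_mult_distrib)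
  qed
  have cases: "AE \<omega> in M. ?N \<omega> = 0 \<and> \<omega> \<notin> T \<or> ?N \<omega> = 1 \<and> \<omega> \<notin> T \<or> \<omega> \<in> T \<and> ?N \<omega> \<ge> 2"
    using AE_fst_Z_Nats[OF h(1)] AE_space
  proof eventually_elim
    case (elim \<omega>)
    then obtain n where "?N \<omega> = real n" by (auto simp: Nats_def)
    moreover have "n = 0 \<or> n = 1 \<or> n \<ge> 2" by linarith
    ultimately show ?case using elim by (auto simp: T_def)
  qed
  define A where "A j = (CLINT \<omega>|M. indicator {\<omega> \<in> space M. ?N \<omega> = j} \<omega> *\<^sub>R iexp (z * ?L \<omega>))" for j
  have int_A: "integrable M (\<lambda>\<omega>. indicator {\<omega> \<in> space M. ?N \<omega> = j} \<omega> *\<^sub>R iexp (z * ?L \<omega>))" for j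
    by (rule integrable_const_bound[where B = 1]) (auto simp: indicator_def)
  \<comment> \<open>Used twice: for the joint characteristic function, to determine
    \<open>A 0\<close> and \<open>A 1\<close>, and for \<open>step\<close>, to evaluate it from
    them.\<close>
  have decomp: "norm ((CLINT \<omega>|M. f \<omega>) - (A 0 * a0 + A 1 * a1)) \<le> C * prob T"
    if f: "f \<in> borel_measurable M" "C \<ge> 0"
      and f0: "\<And>\<omega>. ?N \<omega> = 0 \<Longrightarrow> f \<omega> = iexp (z * ?L \<omega>) * a0"
      and f1: "\<And>\<omega>. ?N \<omega> = 1 \<Longrightarrow> f \<omega> = iexp (z * ?L \<omega>) * a1"
      and f2: "\<And>\<omega>. ?N \<omega> \<ge> 2 \<Longrightarrow> norm (f \<omega>) \<le> C"
    for f a0 a1 C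
  proof -
    have int_f: "integrable M f"
    proof (rule integrable_const_bound[OF _ f(1)])
      show "AE \<omega> in M. norm (f \<omega>) \<le> norm a0 + norm a1 + C"
        using cases by eventually_elim (use f(2) f0 f1 f2 in \<open>auto simp: norm_mult add_increasing add_increasing2\<close>)
    qed
    let ?g = "\<lambda>\<omega>. indicator {\<omega> \<in> space M. ?N \<omega> = 0} \<omega> *\<^sub>R iexp (z * ?L \<omega>) * a0 +
        indicator {\<omega> \<in> space M. ?N \<omega> = 1} \<omega> *\<^sub>R iexp (z * ?L \<omega>) * a1"
    have int_g: "integrable M ?g"
      by (intro Bochner_Integration.integrable_add integrable_mult_left int_A)
    have "(CLINT \<omega>|M. ?g \<omega>) = A 0 * a0 + A 1 * a1"
      unfolding A_def
      by (simp only: Bochner_Integration.integral_add integrable_mult_left int_A integral_mult_left_zero)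
    then have "(CLINT \<omega>|M. f \<omega>) - (A 0 * a0 + A 1 * a1) = (CLINT \<omega>|M. f \<omega> - ?g \<omega>)"
      by (simp only: Bochner_Integration.integral_diff[OF int_f int_g])
    then have "norm ((CLINT \<omega>|M. f \<omega>) - (A 0 * a0 + A 1 * a1)) = norm (CLINT \<omega>|M. f \<omega> - ?g \<omega>)"
      by (rule arg_cong)
    also have "\<dots> \<le> (LINT \<omega>|M. norm (f \<omega> - ?g \<omega>))"
      by (rule integral_norm_bound)
    also have "\<dots> \<le> (LINT \<omega>|M. C * indicator T \<omega>)"
    proof (rule integral_mono_AE)
      show "integrable M (\<lambda>\<omega>. norm (f \<omega> - ?g \<omega>))"
        by (rule integrable_norm[OF Bochner_Integration.integrable_diff[OF int_f int_g]])
      show "AE \<omega> in M. norm (f \<omega> - ?g \<omega>) \<le> C * indicator T \<omega>"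
        using cases AE_space
      proof eventually_elim
        case (elim \<omega>)
        from elim(1) show ?case
        proof (elim disjE conjE)
          assume "?N \<omega> = 0" "\<omega> \<notin> T"
          then show ?thesis using f0[of \<omega>] elim(2) by simp
        next
          assume "?N \<omega> = 1" "\<omega> \<notin> T"
          then show ?thesis using f1[of \<omega>] elim(2) by simp
        next
          assume "\<omega> \<in> T" "2 \<le> ?N \<omega>"
          then show ?thesis using f2[of \<omega>] by simp
        qed
      qed
    qed (simp add: emeasure_eq_measure integrable_real_indicator)
    also have "\<dots> = C * prob T" by simp
    finally show ?thesis .
  qed
  define E where "E = exp (2 * rate) * (2 * rate)\<^sup>2 * h\<^sup>2"
  have F: "norm (A 0 + \<sigma> * A 1 - 1 - h * kernel y z) \<le> prob T + E"
    if \<sigma>: "iexp y = \<sigma>" "norm \<sigma> = 1" for \<sigma> y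
  proof -
    have "norm ((CLINT \<omega>|M. iexp (y * ?N \<omega> + z * ?L \<omega>)) - (A 0 * 1 + A 1 * \<sigma>)) \<le> 1 * prob T"
    proof (rule decomp)
      show "iexp (y * ?N \<omega> + z * ?L \<omega>) = iexp (z * ?L \<omega>) * \<sigma>" if "?N \<omega> = 1" for \<omega>
        using that \<sigma>(1) by (simp add: distrib_left exp_add mult.commute)
    qed auto
    then have "norm (A 0 + \<sigma> * A 1 - exp (h * kernel y z)) \<le> prob T"
      unfolding joint_char[OF h(1)] by (simp add: norm_minus_commute mult.commute)
    moreover have "norm (exp (h * kernel y z) - 1 - h * kernel y z) \<le> E"
      unfolding E_def by (rule exp_kernel_approx[OF h])
    moreover have "A 0 + \<sigma> * A 1 - 1 - h * kernel y z =
        (A 0 + \<sigma> * A 1 - exp (h * kernel y z)) + (exp (h * kernel y z) - 1 - h * kernel y z)"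
      by simp
    ultimately show ?thesis using norm_triangle_mono by metis
  qed
  \<comment> \<open>First-order parts of \<open>A 0 - 1\<close> and \<open>A 1\<close>. Since
    \<open>iexp pi = -1\<close>, the kernel at the frequencies 0 and pi of N gives
    \<open>k0 + k1\<close> and \<open>k0 - k1\<close>, up to the factor h already included.\<close>
  define k0 where "k0 = h * (of_real v * (iexp z - 1) - of_real u - of_real w)"
  define k1 where "k1 = h * (of_real u + of_real w * iexp (\<kappa> * z))"
  have F0: "norm (A 0 + A 1 - 1 - (k0 + k1)) \<le> prob T + E"
  proof -
    have "h * kernel 0 z = k0 + k1" by (simp add: kernel_def k0_def k1_def algebra_simps)
    then show ?thesis using F[of 0 1] by simp
  qed
  have F1: "norm (A 0 - A 1 - 1 - (k0 - k1)) \<le> prob T + E"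
  proof -
    have "iexp (pi + z * \<kappa>) = - iexp (\<kappa> * z)"
      by (simp add: distrib_left exp_add mult.commute)
    then have "h * kernel pi z = k0 - k1" by (simp add: kernel_def k0_def k1_def algebra_simps)
    then show ?thesis using F[of pi "-1"] by simp
  qed
  have half: "norm ((a + b) / 2) \<le> e" "norm ((a - b) / 2) \<le> e"
    if "norm a \<le> e" "norm b \<le> e" for a b :: complex and e
    using norm_triangle_ineq[of a b] norm_triangle_ineq4[of a b] that by (auto simp: norm_divide)
  have A0: "norm (A 0 - 1 - k0) \<le> prob T + E"
  proof -
    have "((A 0 + A 1 - 1 - (k0 + k1)) + (A 0 - A 1 - 1 - (k0 - k1))) / 2 = A 0 - 1 - k0"
      by (simp add: field_simps)
    then show ?thesis using half(1)[OF F0 F1] by (simp only:)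
  qed
  have A1: "norm (A 1 - k1) \<le> prob T + E"
  proof -
    have "((A 0 + A 1 - 1 - (k0 + k1)) - (A 0 - A 1 - 1 - (k0 - k1))) / 2 = A 1 - k1"
      by (simp add: field_simps)
    then show ?thesis using half(2)[OF F0 F1] by (simp only:)
  qed
  have zc: "\<bar>z / c\<bar> \<le> R" 
  proof -
    have "\<bar>z\<bar> / c \<le> \<bar>z\<bar> / 1" using c by (intro divide_left_mono) auto
    then show ?thesis using z c by (simp add: abs_divide)
  qed
  have S: "norm (step g h z - (A 0 * g z + A 1 * g (z / c))) \<le> B * prob T"
    unfolding step_def
  proof (rule decomp)
    fix \<omega>
    assume N: "?N \<omega> \<ge> 2"
    have "c powr (- ?N \<omega>) \<le> c powr 0" using N c by (intro powr_mono) auto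
    then have "c powr (- ?N \<omega>) * \<bar>z\<bar> \<le> 1 * \<bar>z\<bar>" using c by (intro mult_right_mono) auto
    then have "\<bar>c powr (- ?N \<omega>) * z\<bar> \<le> R" using z by (simp add: abs_mult)
    then show "norm (iexp (z * ?L \<omega>) * g (c powr (- ?N \<omega>) * z)) \<le> B"
      using bound by (simp add: norm_mult)
  qed (use B c in \<open>auto simp: powr_minus divide_inverse mult.commute\<close>)
  \<comment> \<open>The first-order term vanishes precisely by the functional equation.\<close>
  have k: "k0 * g z + k1 * g (z / c) = 0"
  proof -
    have "k0 * g z + k1 * g (z / c) = of_real h * (u * g (z / c) + v * iexp z * g z + w * iexp (\<kappa> * z) * g (z / c) - rate * g z)"
      by (simp add: k0_def k1_def rate_def algebra_simps)
    then show ?thesis by (simp add: eq[OF z])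
  qed
  have "step g h z - g z = (step g h z - (A 0 * g z + A 1 * g (z / c)))
      + ((A 0 - 1 - k0) * g z + (A 1 - k1) * g (z / c)) + (k0 * g z + k1 * g (z / c))"
    by (simp add: algebra_simps)
  then have "norm (step g h z - g z) \<le> norm (step g h z - (A 0 * g z + A 1 * g (z / c)))
      + norm ((A 0 - 1 - k0) * g z + (A 1 - k1) * g (z / c))"
    unfolding k by (metis add.right_neutral norm_triangle_ineq)
  \<comment> \<open>\<open>prob T\<close> enters once through \<open>S\<close> and once through each
    of \<open>A 0\<close> and \<open>A 1\<close>, which explains the constant 3; \<open>E\<close>
    enters only through the latter two.\<close>
  also have "\<dots> \<le> B * prob T + ((prob T + E) * B + (prob T + E) * B)"
  proof (intro add_mono S order_trans[OF norm_triangle_ineq])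
    have "0 \<le> prob T + E" using A0 norm_ge_zero order_trans by blast
    then show "norm ((A 0 - 1 - k0) * g z) \<le> (prob T + E) * B"
      and "norm ((A 1 - k1) * g (z / c)) \<le> (prob T + E) * B"
      unfolding norm_mult using A0 A1 bound[OF z] bound[OF zc] by (auto intro: mult_mono)
  qed
  also have "\<dots> = B * (3 * prob T + 2 * E)" by (simp add: algebra_simps)
  also have "\<dots> \<le> B * (3 * (rate\<^sup>2 * h\<^sup>2) + 2 * E)"
    using PT B by (intro mult_left_mono) auto
  finally show ?thesis by (simp add: E_def algebra_simps)
qed

end

subsection \<open>The law of the exponential integral\<close>

lemma sequence_of_Rats_at_right:
  fixes x b :: real
  assumes "x < b"
  obtains \<rho> where "\<And>n. \<rho> n \<in> \<rat>" "\<And>n. x < \<rho> n" "\<And>n. \<rho> n < b" "filterlim \<rho> (at_right x) sequentially"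
proof -
  have "\<exists>\<rho>\<in>\<rat>. x < \<rho> \<and> \<rho> < min b (x + 1 / real (Suc n))" for n
    using assms by (intro Rats_dense_in_real) auto
  then obtain \<rho> where \<rho>: "\<And>n. \<rho> n \<in> \<rat> \<and> x < \<rho> n \<and> \<rho> n < min b (x + 1 / real (Suc n))" by metis
  have lim: "(\<lambda>n. x + 1 / real (Suc n)) \<longlonglongrightarrow> x"
    using LIMSEQ_inverse_real_of_nat_add[of x] by (simp add: divide_inverse)
  have "\<rho> \<longlonglongrightarrow> x"
    by (rule tendsto_sandwich[OF _ _ tendsto_const lim]) (use \<rho> in \<open>auto intro!: always_eventually less_imp_le\<close>)
  moreover have "\<forall>n. \<rho> n \<in> {x<..} \<and> \<rho> n \<noteq> x" using \<rho> by (auto simp: less_le)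
  ultimately have "filterlim \<rho> (at_right x) sequentially"
    unfolding filterlim_at by (simp only: always_eventually simp_thms)
  then show ?thesis using that \<rho> by auto
qed

text \<open>Monotonicity of L is available almost surely for countably many pairs of times at once;
  right-continuity extends it to all times.\<close>

lemma mono_of_mono_on_Rats:
  fixes F :: "real \<Rightarrow> real"
  assumes rcont: "\<And>x. 0 \<le> x \<Longrightarrow> continuous (at_right x) F"
    and mono: "\<And>x y. x \<in> \<rat> \<Longrightarrow> y \<in> \<rat> \<Longrightarrow> 0 \<le> x \<Longrightarrow> x \<le> y \<Longrightarrow> F x \<le> F y"
    and "0 \<le> x" "x \<le> y"
  shows "F x \<le> F y"
proof (cases "x = y")
  case False
  then have "x < y" using \<open>x \<le> y\<close> by simp
  obtain \<rho> where \<rho>: "\<And>n. \<rho> n \<in> \<rat>" "\<And>n. x < \<rho> n" "\<And>n. \<rho> n < y" "filterlim \<rho> (at_right x) sequentially"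
    using sequence_of_Rats_at_right[OF \<open>x < y\<close>] by blast
  obtain \<tau> where \<tau>: "\<And>n. \<tau> n \<in> \<rat>" "\<And>n. y < \<tau> n" "\<And>n. \<tau> n < y + 1" "filterlim \<tau> (at_right y) sequentially"
    using sequence_of_Rats_at_right[of y "y + 1"] by auto
  have F: "(F \<longlongrightarrow> F a) (at_right a)" if "0 \<le> a" for a
    using rcont[OF that] by (simp add: continuous_within)
  have "(\<lambda>n. F (\<rho> n)) \<longlonglongrightarrow> F x" "(\<lambda>n. F (\<tau> n)) \<longlonglongrightarrow> F y"
    using filterlim_compose[OF F \<rho>(4)] filterlim_compose[OF F \<tau>(4)] assms(3,4) by auto
  moreover have "F (\<rho> n) \<le> F (\<tau> n)" for n
    using \<rho>(1-3)[of n] \<tau>(1-3)[of n] assms(3) by (intro mono) auto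
  ultimately show ?thesis by (intro LIMSEQ_le) auto
qed simp

lemma borel_measurable_fst [measurable]: "fst \<in> borel_measurable (borel :: (real \<times> real) measure)"
  and borel_measurable_snd [measurable]: "snd \<in> borel_measurable (borel :: (real \<times> real) measure)"
  by (auto simp: borel_prod[symmetric])

section \<open>Discretised integrals and independence\<close>

context poisson_pair
begin

definition increment :: "real \<Rightarrow> nat \<Rightarrow> 'a \<Rightarrow> real \<times> real" where
  "increment h i \<omega> = Z (real (Suc i) * h) \<omega> - Z (real i * h) \<omega>"

text \<open>The value of N at the grid point \<open>a * h\<close>, relative to time 0. Writing it
  through increments makes it, like the Riemann sum, a function of the first a increments.\<close>

definition height :: "real \<Rightarrow> nat \<Rightarrow> 'a \<Rightarrow> real" where
  "height h a \<omega> = (\<Sum>i<a. fst (increment h i \<omega>))"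

definition Riemann_sum :: "real \<Rightarrow> nat \<Rightarrow> 'a \<Rightarrow> real" where
  "Riemann_sum h a \<omega> = (\<Sum>i<a. c powr (- height h i \<omega>) * snd (increment h i \<omega>))"

lemma height_eq: "height h a \<omega> = fst (Z (real a * h) \<omega>) - fst (Z 0 \<omega>)"
  using sum_lessThan_telescope[of "\<lambda>i. fst (Z (real i * h) \<omega>)" a]
  by (simp add: height_def increment_def)

lemma measurable_increment_grid: "h \<ge> 0 \<Longrightarrow> increment h i \<in> borel_measurable M"
  unfolding increment_def using measurable_Z by simp

lemma measurable_height: "h \<ge> 0 \<Longrightarrow> height h a \<in> borel_measurable M"
  and measurable_Riemann_sum: "h \<ge> 0 \<Longrightarrow> Riemann_sum h a \<in> borel_measurable M"
proof -
  assume h: "h \<ge> 0"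
  note [measurable] = measurable_increment_grid[OF h]
  show [measurable]: "height h a \<in> borel_measurable M" for a unfolding height_def by measurable
  show "Riemann_sum h a \<in> borel_measurable M" unfolding Riemann_sum_def by measurable
qed

lemma distr_increment:
  assumes "h \<ge> 0"
  shows "distr M borel (increment h i) = distr M borel (Z h)"
  using increment_distr[of "real i * h" h] assms by (simp add: increment_def[abs_def] algebra_simps)

text \<open>The pair is a measurable function of the increments with index below a, and these are
  jointly independent of the one with index a.\<close>

lemma indep_increment:
  assumes h: "h \<ge> 0"
  shows "indep_var (borel \<Otimes>\<^sub>M borel) (\<lambda>\<omega>. (Riemann_sum h a \<omega>, height h a \<omega>)) borel (increment h a)"
proof -
  have "indep_vars (\<lambda>_. borel) (\<lambda>i \<omega>. Z (real (Suc i) * h) \<omega> - Z (real i * h) \<omega>) {..<Suc a}"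
  proof -
    have mono: "mono (\<lambda>i. real i * h)" using h by (auto intro!: monoI mult_right_mono)
    have "\<forall>(t::nat \<Rightarrow> real) n. 0 \<le> t 0 \<and> mono t \<longrightarrow>
        indep_vars (\<lambda>_. borel) (\<lambda>i \<omega>. Z (t (Suc i)) \<omega> - Z (t i) \<omega>) {..<n}"
      using levy unfolding levy_process_def by blast
    from this[rule_format, of "\<lambda>i. real i * h" "Suc a"] show ?thesis using mono by simp
  qed
  then have "indep_vars (\<lambda>_. borel) (increment h) {..<Suc a}"
    by (simp add: increment_def[abs_def])
  then have "indep_var (PiM {..<a} (\<lambda>_. borel)) (\<lambda>\<omega>. restrict (\<lambda>i. increment h i \<omega>) {..<a})
      (PiM {a} (\<lambda>_. borel)) (\<lambda>\<omega>. restrict (\<lambda>i. increment h i \<omega>) {a})"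
    by (rule indep_var_restrict) auto
  moreover
  define G where "G x = ((\<Sum>i<a. c powr (- (\<Sum>j<i. fst (x j))) * snd (x i)), (\<Sum>i<a. fst (x i)))"
    for x :: "nat \<Rightarrow> real \<times> real"
  have "G \<in> measurable (PiM {..<a} (\<lambda>_. borel)) (borel \<Otimes>\<^sub>M borel)"
  proof -
    have comp [measurable]: "(\<lambda>x. x i) \<in> measurable (PiM {..<a} (\<lambda>_. borel :: (real \<times> real) measure)) borel"
      if "i < a" for i
      using that by (intro measurable_component_singleton) auto
    have f: "(\<lambda>x. fst (x i)) \<in> borel_measurable (PiM {..<a} (\<lambda>_. borel :: (real \<times> real) measure))"
      and s: "(\<lambda>x. snd (x i)) \<in> borel_measurable (PiM {..<a} (\<lambda>_. borel :: (real \<times> real) measure))"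
      if "i < a" for i
      using measurable_compose[OF comp[OF that] borel_measurable_fst]
        measurable_compose[OF comp[OF that] borel_measurable_snd] by simp_all
    show ?thesis unfolding G_def
      by (intro measurable_Pair borel_measurable_sum borel_measurable_times powr_real_measurable
          borel_measurable_uminus borel_measurable_const f s) auto
  qed
  moreover have "(\<lambda>x. x a) \<in> measurable (PiM {a} (\<lambda>_. borel :: (real \<times> real) measure)) borel"
    by (intro measurable_component_singleton) auto
  ultimately have "indep_var (borel \<Otimes>\<^sub>M borel) (G \<circ> (\<lambda>\<omega>. restrict (\<lambda>i. increment h i \<omega>) {..<a}))
      borel ((\<lambda>x. x a) \<circ> (\<lambda>\<omega>. restrict (\<lambda>i. increment h i \<omega>) {a}))"
    by (rule indep_var_compose)
  moreover have "G \<circ> (\<lambda>\<omega>. restrict (\<lambda>i. increment h i \<omega>) {..<a}) = (\<lambda>\<omega>. (Riemann_sum h a \<omega>, height h a \<omega>))"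
    by (auto simp: fun_eq_iff G_def Riemann_sum_def height_def intro!: sum.cong)
  moreover have "(\<lambda>x. x a) \<circ> (\<lambda>\<omega>. restrict (\<lambda>i. increment h i \<omega>) {a}) = increment h a"
    by (auto simp: fun_eq_iff)
  ultimately show ?thesis by simp
qed

lemma measurable_step:
  assumes [measurable]: "g \<in> borel_measurable borel" and h: "h \<ge> 0"
  shows "step g h \<in> borel_measurable borel"
proof -
  note [measurable] = measurable_fst_Z[OF h] measurable_snd_Z[OF h]
  show ?thesis unfolding step_def[abs_def] by measurable
qed

text \<open>Integrating out the last increment, which is independent of the past and distributed as
  \<open>Z h\<close>. The accumulated factor \<open>c powr (- height h a \<omega>)\<close> rescales
  the frequency at which \<open>step\<close> is evaluated.\<close>

lemma expectation_Suc:
  assumes g [measurable]: "g \<in> borel_measurable borel" and bound: "\<And>z. norm (g z) \<le> B" and h: "h \<ge> 0"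
  shows "(CLINT \<omega>|M. iexp (z * Riemann_sum h (Suc a) \<omega>) * g (c powr (- height h (Suc a) \<omega>) * z)) =
    (CLINT \<omega>|M. iexp (z * Riemann_sum h a \<omega>) * step g h (c powr (- height h a \<omega>) * z))"
proof -
  define U where "U = (\<lambda>\<omega>. (Riemann_sum h a \<omega>, height h a \<omega>))"
  define f :: "(real \<times> real) \<times> real \<times> real \<Rightarrow> complex" where
    "f x = iexp (z * (fst (fst x) + c powr (- snd (fst x)) * snd (snd x))) *
      g (c powr (- (snd (fst x) + fst (snd x))) * z)" for x
  note [measurable] = measurable_increment_grid[OF h] measurable_Riemann_sum[OF h] measurable_height[OF h]
    measurable_Z[OF h] measurable_step[OF g h]
  have U [measurable]: "U \<in> measurable M (borel \<Otimes>\<^sub>M borel)" unfolding U_def by measurable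
  have f [measurable]: "f \<in> borel_measurable ((borel \<Otimes>\<^sub>M borel) \<Otimes>\<^sub>M borel)" unfolding f_def[abs_def] by measurable
  let ?D1 = "distr M (borel \<Otimes>\<^sub>M borel) U" and ?D2 = "distr M borel (Z h)"
  interpret D1: prob_space ?D1 by (rule prob_space_distr) measurable
  interpret D2: prob_space ?D2 by (rule prob_space_distr) measurable
  interpret P: pair_prob_space ?D1 ?D2 ..
  have joint: "?D1 \<Otimes>\<^sub>M ?D2 = distr M ((borel \<Otimes>\<^sub>M borel) \<Otimes>\<^sub>M borel) (\<lambda>\<omega>. (U \<omega>, increment h a \<omega>))"
    using indep_increment[OF h, of a] distr_increment[OF h, of a]
    unfolding indep_var_distribution_eq U_def[symmetric] by simp
  have "(CLINT \<omega>|M. iexp (z * Riemann_sum h (Suc a) \<omega>) * g (c powr (- height h (Suc a) \<omega>) * z)) =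
      (CLINT \<omega>|M. f (U \<omega>, increment h a \<omega>))"
    by (simp add: f_def U_def Riemann_sum_def height_def)
  also have "\<dots> = (CLINT x|?D1 \<Otimes>\<^sub>M ?D2. f x)"
    unfolding joint by (subst integral_distr) auto
  also have "\<dots> = (CLINT x|?D1. CLINT y|?D2. f (x, y))"
  proof (rule P.integral_fst'[symmetric], rule P.integrable_const_bound[where B = B])
    show "AE x in ?D1 \<Otimes>\<^sub>M ?D2. norm (f x) \<le> B"
      using bound by (auto simp: f_def norm_mult split: prod.splits)
  qed simp
  also have "\<dots> = (CLINT x|?D1. iexp (z * fst x) * step g h (c powr (- snd x) * z))"
  proof (rule Bochner_Integration.integral_cong)
    fix x :: "real \<times> real"
    obtain y s where x: "x = (y, s)" by (cases x)
    have "(\<lambda>v. f (x, v)) \<in> borel_measurable borel"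
      by (rule measurable_Pair2[OF f]) (simp add: space_pair_measure)
    then have "(CLINT v|?D2. f (x, v)) = (CLINT \<omega>|M. f (x, Z h \<omega>))"
      by (subst integral_distr) auto
    also have "\<dots> = (CLINT \<omega>|M. iexp (z * y) * (iexp (c powr (- s) * z * snd (Z h \<omega>)) *
        g (c powr (- fst (Z h \<omega>)) * (c powr (- s) * z))))"
      by (rule Bochner_Integration.integral_cong)
         (auto simp: f_def x powr_add powr_minus exp_add[symmetric] distrib_left powr_diff mult_ac divide_inverse)
    also have "\<dots> = iexp (z * fst x) * step g h (c powr (- snd x) * z)"
      by (simp add: step_def x)
    finally show "(CLINT v|?D2. f (x, v)) = iexp (z * fst x) * step g h (c powr (- snd x) * z)" .
  qed simp
  also have "\<dots> = (CLINT \<omega>|M. iexp (z * Riemann_sum h a \<omega>) * step g h (c powr (- height h a \<omega>) * z))"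
    by (subst integral_distr) (auto simp: U_def)
  finally show ?thesis .
qed

end

section \<open>Passage to the limit\<close>

context poisson_pair
begin

lemma AE_height_nonneg:
  assumes "h \<ge> 0"
  shows "AE \<omega> in M. height h a \<omega> \<ge> 0"
  using AE_increment_fst_Nats[of 0 "real a * h"] assms
  unfolding height_eq by (auto simp: Nats_def elim!: eventually_mono)

text \<open>
  For a solution \<open>g\<close> of the functional equation, \<open>exp (i z Y\<^sub>a) g (c\<^bsup>-S\<^sub>a\<^esup> z)\<close> is a martingale up to an
  error \<open>O(h\<^sup>2)\<close> per step.
\<close>

lemma expectation_approx:
  fixes g :: "real \<Rightarrow> complex"
  assumes g: "g \<in> borel_measurable borel" and bound: "\<And>z. norm (g z) \<le> B"
    and eq: "\<And>z. \<bar>z\<bar> \<le> R \<Longrightarrow>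
      rate * g z = u * g (z / c) + v * iexp z * g z + w * iexp (\<kappa> * z) * g (z / c)"
    and h: "0 \<le> h" "h \<le> 1" and z: "\<bar>z\<bar> \<le> R"
  shows "norm ((CLINT \<omega>|M. iexp (z * Riemann_sum h a \<omega>) * g (c powr (- height h a \<omega>) * z)) - g z)
     \<le> real a * (B * (3 * rate\<^sup>2 + 2 * (exp (2 * rate) * (2 * rate)\<^sup>2)) * h\<^sup>2)"
proof (induction a)
  case 0
  show ?case using c by (simp add: Riemann_sum_def height_def prob_space)
next
  case (Suc a)
  define K where "K = B * (3 * rate\<^sup>2 + 2 * (exp (2 * rate) * (2 * rate)\<^sup>2)) * h\<^sup>2"
  define E where "E a = (CLINT \<omega>|M. iexp (z * Riemann_sum h a \<omega>) * g (c powr (- height h a \<omega>) * z))" for a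
  note [measurable] = g measurable_step[OF g h(1)] measurable_Riemann_sum[OF h(1)] measurable_height[OF h(1)]
  \<comment> \<open>Nonnegative height keeps the random argument in the ball of radius R, where the
    functional equation is assumed.\<close>
  have near: "AE \<omega> in M. norm (step g h (c powr (- height h a \<omega>) * z) - g (c powr (- height h a \<omega>) * z)) \<le> K"
    using AE_height_nonneg[OF h(1), of a]
  proof eventually_elim
    case (elim \<omega>)
    have "c powr (- height h a \<omega>) \<le> c powr 0" using elim c by (intro powr_mono) auto
    then have "c powr (- height h a \<omega>) * \<bar>z\<bar> \<le> 1 * \<bar>z\<bar>" using c by (intro mult_right_mono) auto
    then have "\<bar>c powr (- height h a \<omega>) * z\<bar> \<le> R" using z by (simp add: abs_mult)
    then show ?case unfolding K_def using bound by (intro step_approx[OF g _ eq h]) auto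
  qed
  have int_g: "integrable M (\<lambda>\<omega>. iexp (z * Riemann_sum h a \<omega>) * g (c powr (- height h a \<omega>) * z))"
    by (rule integrable_const_bound[where B = B]) (auto simp: norm_mult bound)
  have int_d: "integrable M (\<lambda>\<omega>. iexp (z * Riemann_sum h a \<omega>) *
      (step g h (c powr (- height h a \<omega>) * z) - g (c powr (- height h a \<omega>) * z)))"
    by (rule integrable_const_bound[where B = K]) (use near in \<open>auto simp: norm_mult\<close>)
  have "E (Suc a) = (CLINT \<omega>|M. iexp (z * Riemann_sum h a \<omega>) * step g h (c powr (- height h a \<omega>) * z))"
    unfolding E_def by (rule expectation_Suc[OF g bound h(1)])
  also have "\<dots> = (CLINT \<omega>|M. iexp (z * Riemann_sum h a \<omega>) * g (c powr (- height h a \<omega>) * z) +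
      iexp (z * Riemann_sum h a \<omega>) *
      (step g h (c powr (- height h a \<omega>) * z) - g (c powr (- height h a \<omega>) * z)))"
    by (simp add: distrib_left[symmetric])
  also have "\<dots> = E a + (CLINT \<omega>|M. iexp (z * Riemann_sum h a \<omega>) *
      (step g h (c powr (- height h a \<omega>) * z) - g (c powr (- height h a \<omega>) * z)))"
    unfolding E_def by (rule Bochner_Integration.integral_add[OF int_g int_d])
  finally have "norm (E (Suc a) - E a) = norm (CLINT \<omega>|M. iexp (z * Riemann_sum h a \<omega>) *
      (step g h (c powr (- height h a \<omega>) * z) - g (c powr (- height h a \<omega>) * z)))"
    by simp
  also have "\<dots> \<le> (LINT \<omega>|M. norm (iexp (z * Riemann_sum h a \<omega>) *
      (step g h (c powr (- height h a \<omega>) * z) - g (c powr (- height h a \<omega>) * z))))"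
    by (rule integral_norm_bound)
  also have "\<dots> \<le> (LINT \<omega>|M. K)"
    by (rule integral_mono_AE[OF integrable_norm[OF int_d]]) (use near in \<open>auto simp: norm_mult\<close>)
  also have "\<dots> = K" by (simp add: prob_space)
  finally have "norm (E (Suc a) - E a) \<le> K" .
  moreover have "norm (E a - g z) \<le> real a * K" using Suc unfolding K_def E_def .
  moreover have "norm (E (Suc a) - g z) \<le> norm (E (Suc a) - E a) + norm (E a - g z)"
    using norm_triangle_ineq[of "E (Suc a) - E a" "E a - g z"] by simp
  ultimately have "norm (E (Suc a) - g z) \<le> real (Suc a) * K" by (simp add: distrib_right)
  then show ?case unfolding K_def E_def .
qed

lemma AE_paths:
  "AE \<omega> in M. cadlag (\<lambda>t. Z t \<omega>) \<and> Z 0 \<omega> = 0 \<and>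
     (\<forall>x y. 0 \<le> x \<longrightarrow> x \<le> y \<longrightarrow> snd (Z x \<omega>) \<le> snd (Z y \<omega>))"
proof -
  have "AE \<omega> in M. cadlag (\<lambda>t. Z t \<omega>)" using levy by (simp add: levy_process_def)
  moreover have "AE \<omega> in M. \<forall>x\<in>\<rat>. \<forall>y\<in>\<rat>. 0 \<le> x \<longrightarrow> x \<le> y \<longrightarrow> snd (Z x \<omega>) \<le> snd (Z y \<omega>)"
    unfolding AE_ball_countable[OF countable_rat]
    by (auto intro!: AE_increment_snd_nonneg)
  ultimately show ?thesis using AE_Z_zero
  proof eventually_elim
    case (elim \<omega>)
    have "continuous (at_right x) (\<lambda>t. snd (Z t \<omega>))" if "0 \<le> x" for x
      using elim(1) that unfolding cadlag_def by (auto intro: continuous_snd)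
    then show ?case
      using elim mono_of_mono_on_Rats[of "\<lambda>t. snd (Z t \<omega>)"] by blast
  qed
qed

lemma AE_Riemann_sum_tendsto:
  assumes t: "t > 0"
  shows "AE \<omega> in M. (\<lambda>n. Riemann_sum (t / real (Suc n)) (Suc n) \<omega>) \<longlonglongrightarrow> exp_integral c Z t \<omega>"
proof -
  have "AE \<omega> in M. \<forall>n i. 0 \<le> fst (Z (real i * (t / real (Suc n))) \<omega>)"
    unfolding AE_all_countable using t by (intro allI AE_fst_Z_nonneg) auto
  then show ?thesis using AE_paths
  proof eventually_elim
    case (elim \<omega>)
    then have Z0: "Z 0 \<omega> = 0" by blast
    have mono: "snd (Z x \<omega>) \<le> snd (Z y \<omega>)" if "0 \<le> x" "x \<le> y" for x y
      using elim(2) that by blast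
    have cadlag: "cadlag (\<lambda>t. Z t \<omega>)" using elim(2) by blast
    have rcont: "continuous (at_right x) (\<lambda>t. snd (Z t \<omega>))" if "0 \<le> x" for x
    proof -
      have "continuous (at_right x) (\<lambda>t. Z t \<omega>)"
        using cadlag that unfolding cadlag_def by blast
      then show ?thesis by (rule continuous_snd)
    qed
    have left: "\<exists>l. ((\<lambda>r. fst (Z r \<omega>)) \<longlongrightarrow> l) (at_left s)" if s: "0 < s" for s
    proof -
      obtain l where "((\<lambda>r. Z r \<omega>) \<longlongrightarrow> l) (at_left s)"
        using cadlag s unfolding cadlag_def by blast
      then show ?thesis by (intro exI[of _ "fst l"] tendsto_fst)
    qed
    have nonneg: "0 \<le> fst (Z (real i * (t / real (Suc n))) \<omega>)" for n i
      using elim(1) by blast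
    note Riemann_sums_tendsto_Stieltjes[where F = "\<lambda>x. snd (Z x \<omega>)" and f = "\<lambda>x. fst (Z x \<omega>)",
        OF c t mono rcont left nonneg]
    then show ?case
      by (simp only: exp_integral_def Riemann_sum_def height_eq increment_def snd_diff Z0 fst_zero diff_zero)
  qed
qed

text \<open>The limits are taken in this order: refining the mesh at the fixed time
  \<open>Suc n\<close> gives an exact identity, and then n tends to infinity.\<close>

lemma char_exp_integral_law:
  fixes g :: "real \<Rightarrow> complex"
  assumes law: "is_exp_integral_law c M Z \<mu>" and uw: "u + w > 0"
    and g: "g \<in> borel_measurable borel"
    and near: "\<And>R. \<exists>C\<ge>0. \<forall>z. \<bar>z\<bar> \<le> R \<longrightarrow> norm (g z - 1) \<le> C * \<bar>z\<bar>"
    and eq: "\<And>z. rate * g z = u * g (z / c) + v * iexp z * g z + w * iexp (\<kappa> * z) * g (z / c)"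
  shows "real_distribution \<mu>" and "char \<mu> z = g z"
proof -
  obtain X where X [measurable]: "X \<in> borel_measurable M"
    and lim_X: "AE \<omega> in M. ((\<lambda>t. exp_integral c Z t \<omega>) \<longlongrightarrow> X \<omega>) at_top" and \<mu>: "\<mu> = distr M borel X"
    using law by (auto simp: is_exp_integral_law_def)
  show "real_distribution \<mu>" unfolding \<mu> by (rule real_distribution_distr) fact
  define R where "R = \<bar>z\<bar>"
  have z: "\<bar>z\<bar> \<le> R" by (simp add: R_def)
  obtain C where C: "C \<ge> 0" and near_R: "\<And>z. \<bar>z\<bar> \<le> R \<Longrightarrow> norm (g z - 1) \<le> C * \<bar>z\<bar>"
    using near by blast
  \<comment> \<open>The cut-off makes the function globally bounded. The ball of radius R is mapped
    into itself by division by c, so the functional equation survives inside it.\<close>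
  define g' where "g' x = (if \<bar>x\<bar> \<le> R then g x else 0)" for x
  have g' [measurable]: "g' \<in> borel_measurable borel"
    using g unfolding g'_def[abs_def] by measurable
  define B where "B = 1 + C * R"
  have B: "norm (g' x) \<le> B" for x
  proof (cases "\<bar>x\<bar> \<le> R")
    case True
    have "norm (g x) \<le> norm (g x - 1) + 1" using norm_triangle_sub[of "g x" 1] by simp
    also have "\<dots> \<le> C * R + 1" using near_R[OF True] mult_left_mono[OF True C] by simp
    finally show ?thesis using True by (simp add: g'_def B_def)
  qed (use C in \<open>auto simp: g'_def B_def R_def\<close>)
  have eq': "rate * g' x = u * g' (x / c) + v * iexp x * g' x + w * iexp (\<kappa> * x) * g' (x / c)"
    if x: "\<bar>x\<bar> \<le> R" for x
  proof -
    have "\<bar>x\<bar> / c \<le> \<bar>x\<bar> / 1" using c by (intro divide_left_mono) auto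
    then have "\<bar>x / c\<bar> \<le> R" using x c by (simp add: abs_divide)
    then show ?thesis using x eq[of x] by (simp add: g'_def)
  qed
  define K where "K = B * (3 * rate\<^sup>2 + 2 * (exp (2 * rate) * (2 * rate)\<^sup>2))"
  \<comment> \<open>\<open>exp_integral c Z t\<close> is not known to be measurable, so it is replaced by the limit of its
    Riemann sums.\<close>
  define I where "I n \<omega> = lim (\<lambda>l. Riemann_sum (real (Suc n) / real (Suc l)) (Suc l) \<omega>)" for n \<omega>
  have I_measurable [measurable]: "I n \<in> borel_measurable M" for n
  proof -
    have [measurable]: "Riemann_sum (real (Suc n) / real (Suc l)) (Suc l) \<in> borel_measurable M" for l
      by (rule measurable_Riemann_sum) simp
    show ?thesis unfolding I_def[abs_def] by measurable
  qed
  have I_lim: "AE \<omega> in M. (\<lambda>l. Riemann_sum (real (Suc n) / real (Suc l)) (Suc l) \<omega>) \<longlonglongrightarrow> I n \<omega>"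
    and I_eq: "AE \<omega> in M. I n \<omega> = exp_integral c Z (real (Suc n)) \<omega>" for n
    using AE_Riemann_sum_tendsto[of "real (Suc n)"]
    by (auto elim!: eventually_mono simp: I_def limI)
  have I_X: "AE \<omega> in M. (\<lambda>n. I n \<omega>) \<longlonglongrightarrow> X \<omega>"
  proof -
    have "AE \<omega> in M. \<forall>n. I n \<omega> = exp_integral c Z (real (Suc n)) \<omega>"
      unfolding AE_all_countable using I_eq by blast
    then show ?thesis using lim_X
    proof eventually_elim
      case (elim \<omega>)
      have "filterlim (\<lambda>n. real (Suc n)) at_top sequentially"
        by (rule filterlim_compose[OF filterlim_real_sequentially filterlim_Suc])
      from filterlim_compose[OF elim(2) this] show ?case using elim(1) by simp
    qed
  qed
  have N_meas: "(\<lambda>\<omega>. fst (Z (real (Suc n)) \<omega>)) \<in> borel_measurable M" for n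
    by (rule measurable_fst_Z) simp
  note [measurable] = N_meas
  have exact: "(CLINT \<omega>|M. iexp (z * I n \<omega>) * g' (c powr (- fst (Z (real (Suc n)) \<omega>)) * z)) = g z" for n
  proof -
    let ?h = "\<lambda>l. real (Suc n) / real (Suc l)"
    let ?G = "\<lambda>\<omega>. g' (c powr (- fst (Z (real (Suc n)) \<omega>)) * z)"
    let ?E = "\<lambda>l. CLINT \<omega>|M. iexp (z * Riemann_sum (?h l) (Suc l) \<omega>) * ?G \<omega>"
    have [measurable]: "Riemann_sum (?h l) (Suc l) \<in> borel_measurable M" for l
      by (rule measurable_Riemann_sum) simp
    \<comment> \<open>There are \<open>Suc l\<close> steps, each with an error of order
      \<open>1 / (Suc l)\<^sup>2\<close>; \<open>l \<ge> n\<close> ensures mesh at most 1.\<close>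
    have h1: "norm (?E l - g z) \<le> K * (real (Suc n))\<^sup>2 * (1 / real (Suc l))" if "l \<ge> n" for l
    proof -
      have "?E l = (CLINT \<omega>|M. iexp (z * Riemann_sum (?h l) (Suc l) \<omega>) * g' (c powr (- height (?h l) (Suc l) \<omega>) * z))"
      proof (rule integral_cong_AE)
        show "AE \<omega> in M. iexp (z * Riemann_sum (?h l) (Suc l) \<omega>) * ?G \<omega> =
            iexp (z * Riemann_sum (?h l) (Suc l) \<omega>) * g' (c powr (- height (?h l) (Suc l) \<omega>) * z)"
          using AE_Z_zero by eventually_elim (simp add: height_eq)
        have [measurable]: "height (?h l) (Suc l) \<in> borel_measurable M"
          by (rule measurable_height) simp
        show "(\<lambda>\<omega>. iexp (z * Riemann_sum (?h l) (Suc l) \<omega>) * g' (c powr (- height (?h l) (Suc l) \<omega>) * z))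
            \<in> borel_measurable M"
          by measurable
      qed measurable
      moreover have "norm (\<dots> - g' z) \<le> real (Suc l) * (K * (?h l)\<^sup>2)"
        unfolding K_def by (rule expectation_approx[OF g' B eq' _ _ z]) (use that in auto)
      moreover have "real (Suc l) * (K * (?h l)\<^sup>2) = K * (real (Suc n))\<^sup>2 * (1 / real (Suc l))"
        by (simp add: power2_eq_square field_simps del: of_nat_Suc)
      ultimately show ?thesis using z by (simp add: g'_def)
    qed
    have "(\<lambda>l. ?E l - g z) \<longlonglongrightarrow> 0"
    proof (rule Lim_null_comparison)
      show "\<forall>\<^sub>F l in sequentially. norm (?E l - g z) \<le> K * (real (Suc n))\<^sup>2 * (1 / real (Suc l))"
        using eventually_ge_at_top[of n] by (rule eventually_mono) (rule h1)
      show "(\<lambda>l. K * (real (Suc n))\<^sup>2 * (1 / real (Suc l))) \<longlonglongrightarrow> 0"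
        using tendsto_mult_right_zero[OF LIMSEQ_inverse_real_of_nat, of "K * (real (Suc n))\<^sup>2"]
        by (simp add: divide_inverse)
    qed
    then have "?E \<longlonglongrightarrow> g z" by (simp add: LIM_zero_iff)
    moreover have "?E \<longlonglongrightarrow> (CLINT \<omega>|M. iexp (z * I n \<omega>) * ?G \<omega>)"
    proof (rule integral_dominated_convergence[where w = "\<lambda>_. B"])
      show "AE \<omega> in M. (\<lambda>l. iexp (z * Riemann_sum (?h l) (Suc l) \<omega>) * ?G \<omega>) \<longlonglongrightarrow> iexp (z * I n \<omega>) * ?G \<omega>"
        using I_lim[of n] by eventually_elim (intro tendsto_intros)
      show "(\<lambda>\<omega>. iexp (z * I n \<omega>) * ?G \<omega>) \<in> borel_measurable M"
        and "(\<lambda>\<omega>. iexp (z * Riemann_sum (?h l) (Suc l) \<omega>) * ?G \<omega>) \<in> borel_measurable M" for l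
        by measurable
    qed (simp_all add: norm_mult B)
    ultimately show ?thesis by (rule LIMSEQ_unique[rotated])
  qed
  \<comment> \<open>The mean of \<open>c powr (- N)\<close> at time 1. Its power
    \<open>a ^ Suc n\<close> bounds the cost of replacing \<open>g'\<close> by 1 at time
    \<open>Suc n\<close>.\<close>
  define a where "a = exp ((u + w) * (1 / c - 1))"
  have a: "0 \<le> a" "a < 1"
  proof -
    have "(u + w) * (1 / c - 1) < 0" using uw c by (intro mult_pos_neg) auto
    then show "a < 1" by (simp add: a_def)
  qed (simp add: a_def)
  have err: "norm ((CLINT \<omega>|M. iexp (z * I n \<omega>)) - g z) \<le> C * \<bar>z\<bar> * a ^ Suc n" for n
  proof -
    let ?P = "\<lambda>\<omega>. c powr (- fst (Z (real (Suc n)) \<omega>))"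
    have P: "AE \<omega> in M. 0 \<le> ?P \<omega> \<and> ?P \<omega> \<le> 1"
      using AE_fst_Z_nonneg[OF of_nat_0_le_iff[of "Suc n"]]
    proof eventually_elim
      case (elim \<omega>)
      then have "?P \<omega> \<le> c powr 0" using c by (intro powr_mono) auto
      then show ?case using c by simp
    qed
    have P_measurable: "?P \<in> borel_measurable M" by measurable
    have int_P: "integrable M ?P"
      by (rule integrable_const_bound[where B = 1, OF _ P_measurable]) (use P in auto)
    have int1: "integrable M (\<lambda>\<omega>. iexp (z * I n \<omega>))"
      by (rule integrable_const_bound[where B = 1]) auto
    have "(\<lambda>\<omega>. iexp (z * I n \<omega>) * g' (?P \<omega> * z)) \<in> borel_measurable M" by measurable
    then have int2: "integrable M (\<lambda>\<omega>. iexp (z * I n \<omega>) * g' (?P \<omega> * z))"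
      by (rule integrable_const_bound[where B = B, rotated]) (simp add: norm_mult B)
    have "(CLINT \<omega>|M. iexp (z * I n \<omega>)) - g z = (CLINT \<omega>|M. iexp (z * I n \<omega>) - iexp (z * I n \<omega>) * g' (?P \<omega> * z))"
      unfolding exact[of n, symmetric] by (rule Bochner_Integration.integral_diff[OF int1 int2, symmetric])
    then have "norm ((CLINT \<omega>|M. iexp (z * I n \<omega>)) - g z) =
        norm (CLINT \<omega>|M. iexp (z * I n \<omega>) - iexp (z * I n \<omega>) * g' (?P \<omega> * z))"
      by (rule arg_cong)
    also have "\<dots> \<le> (LINT \<omega>|M. norm (iexp (z * I n \<omega>) - iexp (z * I n \<omega>) * g' (?P \<omega> * z)))"
      by (rule integral_norm_bound)
    also have "\<dots> \<le> (LINT \<omega>|M. C * \<bar>z\<bar> * ?P \<omega>)"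
    proof (rule integral_mono_AE)
      show "integrable M (\<lambda>\<omega>. norm (iexp (z * I n \<omega>) - iexp (z * I n \<omega>) * g' (?P \<omega> * z)))"
        by (rule integrable_norm[OF Bochner_Integration.integrable_diff[OF int1 int2]])
      show "AE \<omega> in M. norm (iexp (z * I n \<omega>) - iexp (z * I n \<omega>) * g' (?P \<omega> * z)) \<le> C * \<bar>z\<bar> * ?P \<omega>"
        using P
      proof eventually_elim
        case (elim \<omega>)
        have Pz: "\<bar>?P \<omega> * z\<bar> \<le> R"
          using elim mult_right_mono[of "?P \<omega>" 1 "\<bar>z\<bar>"] by (simp add: abs_mult R_def)
        have "iexp (z * I n \<omega>) - iexp (z * I n \<omega>) * g' (?P \<omega> * z) = iexp (z * I n \<omega>) * (1 - g (?P \<omega> * z))"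
          using Pz by (simp add: g'_def right_diff_distrib)
        then have "norm (iexp (z * I n \<omega>) - iexp (z * I n \<omega>) * g' (?P \<omega> * z)) = norm (g (?P \<omega> * z) - 1)"
          by (simp add: norm_mult norm_minus_commute)
        also have "\<dots> \<le> C * \<bar>?P \<omega> * z\<bar>" by (rule near_R[OF Pz])
        also have "\<dots> = C * \<bar>z\<bar> * ?P \<omega>" using elim by (simp add: abs_mult)
        finally show ?case .
      qed
    qed (use int_P in simp)
    also have "\<dots> = C * \<bar>z\<bar> * exp ((u + w) * real (Suc n) * (1 / c - 1))"
      using expectation_powr_fst_Z[of "real (Suc n)"] by simp
    also have "exp ((u + w) * real (Suc n) * (1 / c - 1)) = a ^ Suc n"
      unfolding a_def exp_of_nat_mult[symmetric] by (simp add: mult_ac)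
    finally show ?thesis .
  qed
  have "(\<lambda>n. (CLINT \<omega>|M. iexp (z * I n \<omega>)) - g z) \<longlonglongrightarrow> 0"
  proof (rule Lim_null_comparison)
    show "\<forall>\<^sub>F n in sequentially. norm ((CLINT \<omega>|M. iexp (z * I n \<omega>)) - g z) \<le> C * \<bar>z\<bar> * a ^ Suc n"
      by (intro always_eventually allI err)
    show "(\<lambda>n. C * \<bar>z\<bar> * a ^ Suc n) \<longlonglongrightarrow> 0"
      using a by (intro tendsto_mult_right_zero LIMSEQ_Suc LIMSEQ_power_zero) auto
  qed
  then have "(\<lambda>n. CLINT \<omega>|M. iexp (z * I n \<omega>)) \<longlonglongrightarrow> g z" by (simp add: LIM_zero_iff)
  moreover have "(\<lambda>n. CLINT \<omega>|M. iexp (z * I n \<omega>)) \<longlonglongrightarrow> (CLINT \<omega>|M. iexp (z * X \<omega>))"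
  proof (rule integral_dominated_convergence[where w = "\<lambda>_. 1"])
    show "AE \<omega> in M. (\<lambda>n. iexp (z * I n \<omega>)) \<longlonglongrightarrow> iexp (z * X \<omega>)"
      using I_X by eventually_elim (intro tendsto_intros)
  qed auto
  ultimately have "(CLINT \<omega>|M. iexp (z * X \<omega>)) = g z" by (rule LIMSEQ_unique[rotated])
  then show "char \<mu> z = g z" unfolding \<mu> char_def by (simp add: integral_distr)
qed

end

theorem theorem6p6:
  fixes c p q r :: real
  assumes "c > 1" and "p \<ge> 0" and "q \<ge> 0" and "r \<ge> 0" and "p + q + r = 1"
    and "p > 0" and "r > 0" and "p \<noteq> r"
  shows "\<exists>k0::int. \<forall>k<k0.
           \<forall>(u::real) (v::real) (w::real) (M::'a measure) (Z::real \<Rightarrow> 'a \<Rightarrow> real \<times> real) \<mu>.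
             u \<ge> 0 \<and> v \<ge> 0 \<and> w \<ge> 0 \<and>
             p = u / (u + v + w) \<and> q = v / (u + v + w) \<and> r = w / (u + v + w) \<and>
             compound_poisson_process M Z (jump_measure c k u v w) \<and>
             is_exp_integral_law c M Z \<mu>
             \<longrightarrow> \<mu> \<in> ID0"
proof -
  have params: "law_parameters c p q r"
    by unfold_locales (use assms in auto)
  \<comment> \<open>\<open>T\<close> and \<open>s\<close> do not involve k, so the threshold can be
    fixed before k is chosen.\<close>
  define T where "T = law_parameters.geometric_mass c q"
  define s where "s = law_parameters.s p r"
  have s: "0 < s" "s < 1"
    unfolding s_def using law_parameters.s_pos[OF params] law_parameters.s_less_one[OF params] .
  define \<delta> where "\<delta> = s\<^sup>2 / 2 - s ^ 3 / 3"
  have "s\<^sup>2 * s \<le> s\<^sup>2 * 1" using s by (intro mult_left_mono) auto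
  moreover have "s\<^sup>2 > 0" using s by simp
  moreover have "\<delta> = s\<^sup>2 / 2 - s\<^sup>2 * s / 3" by (simp add: \<delta>_def power2_eq_square power3_eq_cube)
  ultimately have \<delta>: "\<delta> > 0" by linarith
  \<comment> \<open>For \<open>k < - int n\<close> one has \<open>\<kappa> \<ge> c ^ n\<close>,
    which makes the contribution \<open>T / (2 * \<kappa>)\<close> smaller than \<delta>.\<close>
  obtain n where n: "T / (2 * \<delta>) < c ^ n"
    using real_arch_pow[OF assms(1)] by blast
  have ID0: "\<mu> \<in> ID0"
    if k: "k < - int n" and u: "u \<ge> 0" and v: "v \<ge> 0" and w: "w \<ge> 0"
      and pqr: "p = u / (u + v + w)" "q = v / (u + v + w)" "r = w / (u + v + w)"
      and cpp: "compound_poisson_process M Z (jump_measure c k u v w)"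
      and law: "is_exp_integral_law c M Z \<mu>"
    for k u v w \<mu> and M :: "'a measure" and Z
  proof -
    interpret L: law_parameters c p q r k by (rule params)
    interpret P: poisson_pair c u v w k M Z
      by unfold_locales (fact assms(1) u v w cpp)+
    have \<kappa>: "P.\<kappa> = L.\<kappa>" by (simp add: P.\<kappa>_def L.\<kappa>_def)
    \<comment> \<open>The total jump rate. Multiplying the functional equation in p, q, r by it
      gives the form in u, v, w.\<close>
    define \<Lambda> where "\<Lambda> = P.rate"
    have "\<Lambda> \<noteq> 0" using pqr(1) assms(6) by (auto simp: \<Lambda>_def P.rate_def)
    then have rate: "u = \<Lambda> * p" "v = \<Lambda> * q" "w = \<Lambda> * r"
      using pqr by (auto simp: \<Lambda>_def P.rate_def)
    have eq: "\<Lambda> * L.law_char z =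
        u * L.law_char (z / c) + v * iexp z * L.law_char z + w * iexp (P.\<kappa> * z) * L.law_char (z / c)" for z
    proof -
      have "\<Lambda> * L.law_char z - v * iexp z * L.law_char z = \<Lambda> * ((1 - q * iexp z) * L.law_char z)"
        by (simp add: rate(2) algebra_simps)
      also have "\<dots> = u * L.law_char (z / c) + w * iexp (P.\<kappa> * z) * L.law_char (z / c)"
        unfolding L.law_char_functional_equation \<kappa> by (simp add: rate(1,3) algebra_simps)
      finally show ?thesis by (simp add: algebra_simps)
    qed
    have "u \<noteq> 0" using pqr(1) assms(6) by auto
    then have "u + w > 0" using u w by simp
    note char = P.char_exp_integral_law[OF law this _ L.law_char_near_zero eq[unfolded \<Lambda>_def]]
    have meas: "L.law_char \<in> borel_measurable borel"
      by (rule borel_measurable_continuous_onI[OF L.continuous_on_law_char])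
    have "T / (2 * L.\<kappa>) < \<delta>"
    proof -
      have "c ^ n = c powi int n" by simp
      also have "\<dots> \<le> L.\<kappa>"
        unfolding L.\<kappa>_def using k assms(1) by (intro power_int_increasing) auto
      finally have "T / (2 * \<delta>) < L.\<kappa>" using n by simp
      then show ?thesis using \<delta> L.\<kappa>_pos by (simp add: field_simps)
    qed
    then show ?thesis
      using char[OF meas] by (intro L.mem_ID0) (auto simp: T_def s_def \<delta>_def)
  qed
  show ?thesis
    by (rule exI[of _ "- int n"]) (use ID0 in blast)
qed

end
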